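(* Let $A$ be a finite dimensional right comodule algebra over the Connes-Moscovici Hopf algebra $\mathcal{H}_n$, and let $B$ be its subalgebra of coinvariants. Then $A(B)^{\mathcal{H}_n}$ is not a right Hopf Galois extension; that is, there is no right Hopf Galois extension $A(B)^{\mathcal{H}_n}$ with $A$ finite dimensional.
   Context: For a Hopf algebra $H$ and a right $H$-comodule algebra $A$ with coaction $a\mapsto a_{\langle 0\rangle}\otimes a_{\langle 1\rangle}$ and coinvariants $B=\{a\in A: a_{\langle 0\rangle}\otimes a_{\langle 1\rangle}=a\otimes 1_H\}$, the extension $A(B)^H$ is (right) Hopf Galois if $can\colon A\otimes_B A\to A\otimes H$, $a\otimes a'\mapsto aa'_{\langle 0\rangle}\otimes a'_{\langle 1\rangle}$, is bijective. The Connes-Moscovici Hopf algebra $\mathcal{H}_n$ (over $\mathbb{C}$) is the standard one: on the frame bundle $F\mathbb{R}^n$ with coordinates $(x^\mu,y^\mu_j)$, $y\in GL_n(\mathbb{R})$, put $X_k=y^\mu_k\partial/\partial x^\mu$, $Y_i^j=y_i^\mu\partial/\partial y_j^\mu$. On the crossed product $C_c^\infty(F\mathbb{R}^n)\rtimes \mathrm{Diff}(\mathbb{R}^n)$, spanned by elements $gU_\phi^*$, let $X_k(gU_\phi^* )=X_k(g)U_\phi^*$, $Y_i^j(gU_\phi^* )=Y_i^j(g)U_\phi^*$ and $\delta^i_{jk}(gU_\phi^* )=\gamma^i_{jk}(\phi)gU_\phi^*$ with $\gamma^i_{jk}(\phi)(x,y)=(y^{-1}\phi'(x)^{-1}\partial_\mu\phi'(x)\,y)^i_j\,y^\mu_k$.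 $\mathcal{H}_n$ is the algebra of linear operators generated by all $X_k,Y_i^j,\delta^i_{jk}$, with coproduct determined by $h(ab)=h^{(1)}(a)h^{(2)}(b)$ and counit by $h(1)=\varepsilon(h)1$. *)

theory Defs
  imports "HOL-Analysis.Analysis" "HOL-Library.Poly_Mapping"
begin

text \<open>
  All iterated directional derivatives exist up to order \<open>k\<close> and those of order \<open>k\<close> are
  continuous. Only meant for open \<open>S\<close>.
\<close>

fun Ck_on :: "nat \<Rightarrow> 'a::euclidean_space set \<Rightarrow> ('a \<Rightarrow> 'b::real_normed_vector) \<Rightarrow> bool" where
  "Ck_on 0 S f = continuous_on S f"
| "Ck_on (Suc k) S f = ((\<forall>x\<in>S. f differentiable (at x)) \<and>
     (\<forall>v. Ck_on k S (\<lambda>x. frechet_derivative f (at x) v)))"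

definition smooth_on :: "'a::euclidean_space set \<Rightarrow> ('a \<Rightarrow> 'b::real_normed_vector) \<Rightarrow> bool" where
  "smooth_on S f \<longleftrightarrow> (\<forall>k. Ck_on k S f)"

declare Ck_on.simps(2) [simp del]

lemma Ck_on_SucD: "Ck_on (Suc k) S f \<Longrightarrow> Ck_on k S f"
proof (induction k arbitrary: f)
  case 0
  then show ?case
    using differentiable_imp_continuous_within[of f]
    by (auto simp: Ck_on.simps(2) intro: continuous_at_imp_continuous_on)
next
  case (Suc k)
  show ?case
    unfolding Ck_on.simps(2)[of k] using Suc.prems unfolding Ck_on.simps(2)[of "Suc k"] by (blast intro: Suc.IH)
qed

lemma Ck_on_SucD1:
  "Ck_on (Suc k) S f \<Longrightarrow> x \<in> S \<Longrightarrow> (f has_derivative frechet_derivative f (at x)) (at x)"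
  by (simp add: frechet_derivative_works Ck_on.simps(2))

lemma Ck_on_SucD2: "Ck_on (Suc k) S f \<Longrightarrow> Ck_on k S (\<lambda>x. frechet_derivative f (at x) v)"
  by (simp add: Ck_on.simps(2))

lemma Ck_on_cong:
  assumes "open S" "\<And>x. x \<in> S \<Longrightarrow> f x = g x" "Ck_on k S f"
  shows "Ck_on k S g"
  using assms(2,3)
proof (induction k arbitrary: f g)
  case 0
  then show ?case using continuous_on_cong by force
next
  case (Suc k)
  have der: "(g has_derivative frechet_derivative f (at x)) (at x)" if "x \<in> S" for x
    using that Suc.prems assms(1) has_derivative_transform_within_open[of f _ x UNIV S g]
    by (auto simp: frechet_derivative_works Ck_on.simps(2))
  then have eq: "frechet_derivative f (at x) = frechet_derivative g (at x)" if "x \<in> S" for x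
    using that frechet_derivative_at by blast
  have "Ck_on k S (\<lambda>x. frechet_derivative g (at x) v)" for v
  proof (rule Suc.IH[of "\<lambda>x. frechet_derivative f (at x) v"])
    show "Ck_on k S (\<lambda>x. frechet_derivative f (at x) v)" using Suc.prems(2) by (rule Ck_on_SucD2)
  qed (simp only: eq)
  then show ?case using der unfolding Ck_on.simps differentiable_def by blast
qed

lemma Ck_on_SucI:
  assumes S: "open S" and d: "\<And>x. x \<in> S \<Longrightarrow> (f has_derivative f' x) (at x)"
    and c: "\<And>v. Ck_on k S (\<lambda>x. f' x v)"
  shows "Ck_on (Suc k) S f"
proof -
  have eq: "f' x = frechet_derivative f (at x)" if "x \<in> S" for x
    using d[OF that] by (rule frechet_derivative_at)
  have "Ck_on k S (\<lambda>x. frechet_derivative f (at x) v)" for v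
    by (rule Ck_on_cong[OF S _ c[of v]]) (simp add: eq)
  then show ?thesis using d unfolding Ck_on.simps differentiable_def by blast
qed

lemma Ck_on_const: "open S \<Longrightarrow> Ck_on k S (\<lambda>x. c)"
proof (induction k arbitrary: c)
  case (Suc k)
  then show ?case by (intro Ck_on_SucI[where f' = "\<lambda>x v. 0"]) auto
qed auto

lemma Ck_on_linear:
  assumes "open S" "bounded_linear L"
  shows "Ck_on k S L"
proof (cases k)
  case 0
  then show ?thesis using assms by (simp add: linear_continuous_on)
next
  case (Suc m)
  show ?thesis unfolding Suc
    by (rule Ck_on_SucI[OF assms(1) bounded_linear_imp_has_derivative[OF assms(2)] Ck_on_const[OF assms(1)]])
qed

lemma Ck_on_add:
  assumes "open S" "Ck_on k S f" "Ck_on k S g"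
  shows "Ck_on k S (\<lambda>x. f x + g x)"
  using assms(2,3)
proof (induction k arbitrary: f g)
  case 0
  then show ?case by (auto intro: continuous_on_add)
next
  case (Suc k)
  show ?case
    by (intro Ck_on_SucI[OF assms(1) has_derivative_add[OF Ck_on_SucD1[OF Suc.prems(1)] Ck_on_SucD1[OF Suc.prems(2)]]]
        Suc.IH Ck_on_SucD2[OF Suc.prems(1)] Ck_on_SucD2[OF Suc.prems(2)])
qed

lemma Ck_on_bilinear:
  assumes "open S" "bounded_bilinear B" "Ck_on k S f" "Ck_on k S g"
  shows "Ck_on k S (\<lambda>x. B (f x) (g x))"
  using assms(3,4)
proof (induction k arbitrary: f g)
  case 0
  then show ?case using bounded_bilinear.continuous_on[OF assms(2)] by auto
next
  case (Suc k)
  from Suc.prems have "Ck_on k S f" "Ck_on k S g" by (auto dest: Ck_on_SucD)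
  then show ?case
    by (intro Ck_on_SucI[OF assms(1) bounded_bilinear.FDERIV[OF assms(2) Ck_on_SucD1[OF Suc.prems(1)] Ck_on_SucD1[OF Suc.prems(2)]]]
        Suc.IH Ck_on_add[OF assms(1)] Ck_on_SucD2[OF Suc.prems(1)] Ck_on_SucD2[OF Suc.prems(2)])
qed

lemma Ck_on_sum:
  assumes "open S" "\<And>i. i \<in> I \<Longrightarrow> Ck_on k S (f i)"
  shows "Ck_on k S (\<lambda>x. \<Sum>i\<in>I. f i x)"
  using assms(2)
  by (induction I rule: infinite_finite_induct) (auto intro!: Ck_on_const Ck_on_add assms(1))

lemma Ck_on_compose:
  fixes f :: "'b::euclidean_space \<Rightarrow> 'c::real_normed_vector" and g :: "'a::euclidean_space \<Rightarrow> 'b"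
  assumes "open S" "open T" "g ` S \<subseteq> T" "Ck_on k T f" "Ck_on k S g"
  shows "Ck_on k S (\<lambda>x. f (g x))"
  using assms(3-5)
proof (induction k arbitrary: f)
  case 0
  then show ?case by (auto intro: continuous_on_compose2)
next
  case (Suc k)
  let ?D = "\<lambda>x. frechet_derivative f (at x)" and ?G = "\<lambda>x. frechet_derivative g (at x)"
  have gk: "Ck_on k S g" using Suc.prems by (auto dest: Ck_on_SucD)
  have f: "(f has_derivative ?D x) (at x)" if "x \<in> T" for x
    using that Suc.prems(2) by (auto intro: Ck_on_SucD1 Ck_on_SucD2)
  have g: "(g has_derivative ?G x) (at x)" if "x \<in> S" for x
    using that Suc.prems(3) by (auto intro: Ck_on_SucD1 Ck_on_SucD2)
  have D: "Ck_on k T (\<lambda>x. ?D x v)" for v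
    using Suc.prems(2) by (auto intro: Ck_on_SucD1 Ck_on_SucD2)
  have G: "Ck_on k S (\<lambda>x. ?G x v)" for v
    using Suc.prems(3) by (auto intro: Ck_on_SucD1 Ck_on_SucD2)
  show ?case
  proof (rule Ck_on_SucI[OF assms(1), where f' = "\<lambda>x v. \<Sum>b\<in>Basis. (?G x v \<bullet> b) *\<^sub>R ?D (g x) b"])
    fix x assume x: "x \<in> S"
    then have gx: "g x \<in> T" using assms(3) by auto
    have lin: "linear (?D (g x))" using f[OF gx] by (rule has_derivative_linear)
    have repr: "?D (g x) w = (\<Sum>b\<in>Basis. (w \<bullet> b) *\<^sub>R ?D (g x) b)" for w
    proof -
      have "?D (g x) w = ?D (g x) (\<Sum>b\<in>Basis. (w \<bullet> b) *\<^sub>R b)" by (simp add: euclidean_representation)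
      also have "\<dots> = (\<Sum>b\<in>Basis. (w \<bullet> b) *\<^sub>R ?D (g x) b)"
        by (simp add: linear_sum[OF lin] linear_scale[OF lin])
      finally show ?thesis .
    qed
    have "((\<lambda>x. f (g x)) has_derivative (\<lambda>v. ?D (g x) (?G x v))) (at x)"
      using has_derivative_compose[OF g[OF x] f[OF gx]] .
    moreover have "(\<lambda>v. ?D (g x) (?G x v)) = (\<lambda>v. \<Sum>b\<in>Basis. (?G x v \<bullet> b) *\<^sub>R ?D (g x) b)"
      by (rule ext, rule repr)
    ultimately show "((\<lambda>x. f (g x)) has_derivative (\<lambda>v. \<Sum>b\<in>Basis. (?G x v \<bullet> b) *\<^sub>R ?D (g x) b)) (at x)"
      by (rule back_subst)
  next
    fix v
    have "Ck_on k S (\<lambda>x. ?G x v \<bullet> b)" for b :: 'b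
      by (rule Ck_on_bilinear[OF assms(1) bounded_bilinear_inner G Ck_on_const[OF assms(1)]])
    moreover have "Ck_on k S (\<lambda>x. ?D (g x) b)" for b
      using Suc.IH[OF Suc.prems(1) D gk] .
    ultimately show "Ck_on k S (\<lambda>x. \<Sum>b\<in>Basis. (?G x v \<bullet> b) *\<^sub>R ?D (g x) b)"
      by (intro Ck_on_sum[OF assms(1)] Ck_on_bilinear[OF assms(1) bounded_bilinear_scaleR])
  qed
qed

lemma Ck_on_inverse:
  fixes f :: "'a::euclidean_space \<Rightarrow> real"
  assumes "open S" "\<And>x. x \<in> S \<Longrightarrow> f x \<noteq> 0" "Ck_on k S f"
  shows "Ck_on k S (\<lambda>x. inverse (f x))"
  using assms(3)
proof (induction k)
  case 0
  then show ?case using assms(2) by (auto intro: continuous_on_inverse)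
next
  case (Suc k)
  have "Ck_on k S (\<lambda>x. inverse (f x))"
    using Suc by (auto dest: Ck_on_SucD)
  moreover have "Ck_on k S (\<lambda>x. frechet_derivative f (at x) v)" for v
    using Suc.prems by (auto intro: Ck_on_SucD1 Ck_on_SucD2)
  moreover have "Ck_on k S (\<lambda>x. (-1::real))" by (rule Ck_on_const[OF assms(1)])
  ultimately have "Ck_on k S (\<lambda>x. (-1) * (inverse (f x) * frechet_derivative f (at x) v * inverse (f x)))" for v
    by (intro Ck_on_bilinear[OF assms(1) bounded_bilinear_mult])
  then show ?case
    by (intro Ck_on_SucI[OF assms(1), where f' = "\<lambda>x v. - (inverse (f x) * frechet_derivative f (at x) v * inverse (f x))"]
        Deriv.has_derivative_inverse Ck_on_SucD1[OF Suc.prems] assms(2)) auto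
qed

lemma smooth_on_const: "open S \<Longrightarrow> smooth_on S (\<lambda>x. c)"
  unfolding smooth_on_def by (simp add: Ck_on_const)

lemma smooth_on_linear: "open S \<Longrightarrow> bounded_linear L \<Longrightarrow> smooth_on S L"
  unfolding smooth_on_def by (simp add: Ck_on_linear)

lemma smooth_on_add: "open S \<Longrightarrow> smooth_on S f \<Longrightarrow> smooth_on S g \<Longrightarrow> smooth_on S (\<lambda>x. f x + g x)"
  unfolding smooth_on_def using Ck_on_add[of S _ f g] by simp

lemma smooth_on_bilinear: "open S \<Longrightarrow> bounded_bilinear B \<Longrightarrow> smooth_on S f \<Longrightarrow> smooth_on S g
    \<Longrightarrow> smooth_on S (\<lambda>x. B (f x) (g x))"
  unfolding smooth_on_def using Ck_on_bilinear[of S B _ f g] by simp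

lemma smooth_on_sum: "open S \<Longrightarrow> (\<And>i. i \<in> I \<Longrightarrow> smooth_on S (F i)) \<Longrightarrow> smooth_on S (\<lambda>x. \<Sum>i\<in>I. F i x)"
  unfolding smooth_on_def using Ck_on_sum[of S I _ F] by simp

lemma smooth_on_compose: "open S \<Longrightarrow> open T \<Longrightarrow> h ` S \<subseteq> T \<Longrightarrow> smooth_on T f \<Longrightarrow> smooth_on S h
    \<Longrightarrow> smooth_on S (\<lambda>x. f (h x))"
  unfolding smooth_on_def using Ck_on_compose[of S T h _ f] by simp

lemma smooth_on_inverse: "open S \<Longrightarrow> (\<And>x. x \<in> S \<Longrightarrow> q x \<noteq> (0::real)) \<Longrightarrow> smooth_on S q
    \<Longrightarrow> smooth_on S (\<lambda>x. inverse (q x))"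
  unfolding smooth_on_def using Ck_on_inverse[of S q] by simp

lemma smooth_on_cong: "open S \<Longrightarrow> (\<And>x. x \<in> S \<Longrightarrow> f x = g x) \<Longrightarrow> smooth_on S f \<Longrightarrow> smooth_on S g"
  unfolding smooth_on_def using Ck_on_cong[of S f g] by simp

lemma smooth_on_has_derivative:
  "smooth_on S f \<Longrightarrow> x \<in> S \<Longrightarrow> (f has_derivative frechet_derivative f (at x)) (at x)"
  unfolding smooth_on_def by (blast intro: Ck_on_SucD1)

lemma smooth_on_frechet_derivative:
  "smooth_on S f \<Longrightarrow> smooth_on S (\<lambda>x. frechet_derivative f (at x) v)"
  unfolding smooth_on_def by (blast intro: Ck_on_SucD2)

lemma smooth_on_continuous_on: "smooth_on S f \<Longrightarrow> continuous_on S f"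
  unfolding smooth_on_def using Ck_on.simps(1) by blast

lemmas smooth_on_mult = smooth_on_bilinear[OF _ bounded_bilinear_mult]

lemma smooth_on_prod:
  fixes F :: "'i \<Rightarrow> 'a::euclidean_space \<Rightarrow> real"
  assumes "open S" "\<And>i. i \<in> I \<Longrightarrow> smooth_on S (F i)"
  shows "smooth_on S (\<lambda>x. \<Prod>i\<in>I. F i x)"
  using assms(2)
  by (induction I rule: infinite_finite_induct) (auto intro!: smooth_on_const smooth_on_mult assms(1))

lemma smooth_on_linear_compose:
  fixes L :: "'b::euclidean_space \<Rightarrow> 'c::real_normed_vector"
  assumes "open S" "bounded_linear L" "smooth_on S f"
  shows "smooth_on S (\<lambda>x. L (f x))"
  using smooth_on_compose[OF assms(1) open_UNIV _ smooth_on_linear[OF open_UNIV assms(2)] assms(3)] by simp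

lemma smooth_on_vec:
  fixes f :: "'a::euclidean_space \<Rightarrow> 'b::euclidean_space ^ 'n"
  assumes "open S" "\<And>i. smooth_on S (\<lambda>x. f x $ i)"
  shows "smooth_on S f"
proof -
  have "bounded_linear (\<lambda>c::'b. axis i c :: 'b ^ 'n)" for i
    unfolding linear_conv_bounded_linear[symmetric] by (rule linearI) (auto simp: axis_def vec_eq_iff)
  then have "smooth_on S (\<lambda>x. \<Sum>i\<in>UNIV. axis i (f x $ i))"
    by (intro smooth_on_sum[OF assms(1)] smooth_on_linear_compose[OF assms(1) _ assms(2)])
  moreover have "(\<Sum>i\<in>UNIV. axis i (f x $ i)) = f x" for x
    by (simp add: vec_eq_iff axis_def if_distrib cong: if_cong)
  ultimately show ?thesis by simp
qed

lemma smooth_on_vec_nth: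
  fixes f :: "'a::euclidean_space \<Rightarrow> 'b::euclidean_space ^ 'n"
  assumes "open S" "smooth_on S f"
  shows "smooth_on S (\<lambda>x. f x $ i)"
  using smooth_on_linear_compose[OF assms(1) bounded_linear_vec_nth assms(2)] .

lemma smooth_on_matrix:
  fixes f :: "'a::euclidean_space \<Rightarrow> real ^ 'm ^ 'n"
  assumes "open S" "\<And>i j. smooth_on S (\<lambda>x. f x $ i $ j)"
  shows "smooth_on S f"
  by (rule smooth_on_vec[OF assms(1)], rule smooth_on_vec[OF assms(1)], rule assms(2))

lemma smooth_on_matrix_mult:
  fixes f :: "'a::euclidean_space \<Rightarrow> real ^ 'm ^ 'n" and g :: "'a \<Rightarrow> real ^ 'k ^ 'm"
  assumes "open S" "smooth_on S f" "smooth_on S g"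
  shows "smooth_on S (\<lambda>x. f x ** g x)"
proof (rule smooth_on_matrix[OF assms(1)])
  fix i j
  have "smooth_on S (\<lambda>x. \<Sum>l\<in>UNIV. f x $ i $ l * g x $ l $ j)"
    by (intro smooth_on_sum[OF assms(1)] smooth_on_mult[OF assms(1)] smooth_on_vec_nth[OF assms(1)] assms)
  then show "smooth_on S (\<lambda>x. (f x ** g x) $ i $ j)" by (simp add: matrix_matrix_mult_def)
qed

lemma matrix_inv_nth:
  fixes A :: "real ^ 'n ^ 'n"
  assumes "invertible A"
  shows "matrix_inv A $ k $ m =
    det (\<chi> i j. if j = k then axis m 1 $ i else A $ i $ j) * inverse (det A)"
proof -
  have "det A \<noteq> 0" using assms by (simp add: invertible_det_nz)
  moreover have "A ** matrix_inv A = mat 1"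
    using assms unfolding invertible_def matrix_inv_def by (metis (mono_tags, lifting) someI_ex)
  then have "A *v (matrix_inv A *v axis m 1) = axis m 1"
    by (simp add: matrix_vector_mul_assoc)
  ultimately have "matrix_inv A *v axis m 1 = (\<chi> k. det (\<chi> i j. if j = k then axis m 1 $ i else A $ i $ j) / det A)"
    using cramer by blast
  then have "(matrix_inv A *v axis m 1) $ k = det (\<chi> i j. if j = k then axis m 1 $ i else A $ i $ j) / det A"
    by simp
  then show ?thesis by (simp add: matrix_vector_mul_component inner_axis divide_inverse)
qed

lemma smooth_on_det:
  fixes f :: "'a::euclidean_space \<Rightarrow> real ^ 'n ^ 'n"
  assumes "open S" "smooth_on S f"
  shows "smooth_on S (\<lambda>x. det (f x))"
  using assms unfolding det_def
  by (intro smooth_on_sum smooth_on_mult smooth_on_const smooth_on_prod smooth_on_vec_nth)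

lemma smooth_on_matrix_inv:
  fixes f :: "'a::euclidean_space \<Rightarrow> real ^ 'n ^ 'n"
  assumes S: "open S" and f: "smooth_on S f" and inv: "\<And>x. x \<in> S \<Longrightarrow> invertible (f x)"
  shows "smooth_on S (\<lambda>x. matrix_inv (f x))"
proof (rule smooth_on_matrix[OF S])
  fix k m
  have "smooth_on S (\<lambda>x. \<chi> i j. if j = k then axis m (1::real) $ i else f x $ i $ j)"
  proof (rule smooth_on_matrix[OF S])
    fix i j
    show "smooth_on S (\<lambda>x. (\<chi> i j. if j = k then axis m (1::real) $ i else f x $ i $ j) $ i $ j)"
      by (cases "j = k") (simp_all add: smooth_on_const[OF S] smooth_on_vec_nth[OF S] f)
  qed
  then have "smooth_on S (\<lambda>x. det (\<chi> i j. if j = k then axis m 1 $ i else f x $ i $ j) * inverse (det (f x)))"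
    using S f inv
    by (intro smooth_on_mult smooth_on_inverse smooth_on_det) (auto simp: invertible_det_nz)
  then show "smooth_on S (\<lambda>x. matrix_inv (f x) $ k $ m)"
    by (rule smooth_on_cong[OF S, rotated]) (simp add: matrix_inv_nth inv)
qed

text \<open>
  The frame bundle of \<open>\<real>\<^sup>n\<close>, with \<open>n = CARD('n) \<ge> 1\<close>, in the coordinates \<open>(x\<^sup>\<mu>, y\<^sup>\<mu>\<^sub>j)\<close>,
  where \<open>y\<^sup>\<mu>\<^sub>j\<close> is \<open>y $ \<mu> $ j\<close>: the upper index is the row, the lower one the column.
\<close>

type_synonym 'n frame = "(real ^ 'n) \<times> (real ^ 'n ^ 'n)"

definition frame_bundle :: "('n::finite) frame set" where
  "frame_bundle = {(x, y). invertible y}"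

lemma open_frame_bundle: "open (frame_bundle :: ('n::finite) frame set)"
proof -
  have "continuous_on UNIV (\<lambda>p :: 'n frame. det (snd p))"
    by (rule smooth_on_continuous_on[OF smooth_on_det[OF open_UNIV smooth_on_linear[OF open_UNIV bounded_linear_snd]]])
  then have "open {p :: 'n frame. det (snd p) \<noteq> 0}"
    by (intro open_Collect_neq) auto
  moreover have "frame_bundle = {p :: 'n frame. det (snd p) \<noteq> 0}"
    by (auto simp: frame_bundle_def invertible_det_nz)
  ultimately show ?thesis by simp
qed

typedef 'n diffeo = "{\<phi> :: real ^ 'n::finite \<Rightarrow> real ^ 'n.
    bij \<phi> \<and> smooth_on UNIV \<phi> \<and> smooth_on UNIV (inv \<phi>)}"
  by (rule exI[of _ id]) (simp add: smooth_on_linear id_def bounded_linear_ident inv_id[unfolded id_def] bij_id[unfolded id_def])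

setup_lifting type_definition_diffeo

lift_definition diffeo_id :: "('n::finite) diffeo" is "\<lambda>x. x"
  by (simp add: smooth_on_linear bounded_linear_ident bij_id[unfolded id_def] inv_id[unfolded id_def])

lift_definition diffeo_comp :: "('n::finite) diffeo \<Rightarrow> 'n diffeo \<Rightarrow> 'n diffeo" is "\<lambda>\<psi> \<phi> x. \<psi> (\<phi> x)"
proof -
  fix \<psi> \<phi> :: "real ^ 'n \<Rightarrow> real ^ 'n"
  assume \<psi>: "bij \<psi> \<and> smooth_on UNIV \<psi> \<and> smooth_on UNIV (inv \<psi>)"
    and \<phi>: "bij \<phi> \<and> smooth_on UNIV \<phi> \<and> smooth_on UNIV (inv \<phi>)"
  have b: "bij (\<lambda>x. \<psi> (\<phi> x))" using \<psi> \<phi> bij_comp[of \<phi> \<psi>] by (simp add: comp_def)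
  have "inv (\<lambda>x. \<psi> (\<phi> x)) = (\<lambda>x. inv \<phi> (inv \<psi> x))"
    using \<psi> \<phi> by (intro inv_equality) (auto simp: bij_is_inj bij_is_surj surj_f_inv_f)
  moreover have "smooth_on UNIV (\<lambda>x. inv \<phi> (inv \<psi> x))"
    using \<psi> \<phi> by (intro smooth_on_compose[OF open_UNIV open_UNIV subset_UNIV, of "inv \<phi>" "inv \<psi>"]) simp_all
  moreover have "smooth_on UNIV (\<lambda>x. \<psi> (\<phi> x))"
    using \<psi> \<phi> by (intro smooth_on_compose[OF open_UNIV open_UNIV subset_UNIV, of \<psi> \<phi>]) simp_all
  ultimately show "bij (\<lambda>x. \<psi> (\<phi> x)) \<and> smooth_on UNIV (\<lambda>x. \<psi> (\<phi> x)) \<and> smooth_on UNIV (inv (\<lambda>x. \<psi> (\<phi> x)))"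
    using b by simp
qed

definition diffeo_jacobian :: "('n::finite) diffeo \<Rightarrow> real ^ 'n \<Rightarrow> real ^ 'n ^ 'n" where
  "diffeo_jacobian \<phi> x = jacobian (Rep_diffeo \<phi>) (at x)"

text \<open>
  The prolongation \<open>(x, y) \<mapsto> (\<phi>(x), \<phi>'(x) y)\<close> of a diffeomorphism to the frame bundle.
\<close>

definition frame_lift :: "('n::finite) diffeo \<Rightarrow> 'n frame \<Rightarrow> 'n frame" where
  "frame_lift \<phi> = (\<lambda>(x, y). (Rep_diffeo \<phi> x, diffeo_jacobian \<phi> x ** y))"

lift_definition diffeo_inv :: "('n::finite) diffeo \<Rightarrow> 'n diffeo" is "inv"
  by (auto simp: bij_imp_bij_inv inv_inv_eq)

lemma diffeo_inv_cancel:
  "Rep_diffeo (diffeo_inv \<phi>) (Rep_diffeo \<phi> x) = x" "Rep_diffeo \<phi> (Rep_diffeo (diffeo_inv \<phi>) x) = x"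
  by (transfer, simp add: bij_inv_eq_iff bij_is_inj bij_is_surj surj_f_inv_f)+

lemma smooth_diffeo: "smooth_on UNIV (Rep_diffeo \<phi>)"
  by transfer simp

lemma diffeo_has_derivative: "(Rep_diffeo \<phi> has_derivative (\<lambda>v. diffeo_jacobian \<phi> x *v v)) (at x)"
  unfolding diffeo_jacobian_def using smooth_on_has_derivative[OF smooth_diffeo, of x \<phi>]
  by (auto simp: jacobian_works[symmetric] differentiable_def)

lemma diffeo_jacobian_inv:
  "diffeo_jacobian (diffeo_inv \<phi>) (Rep_diffeo \<phi> x) ** diffeo_jacobian \<phi> x = mat 1"
proof -
  let ?A = "diffeo_jacobian (diffeo_inv \<phi>) (Rep_diffeo \<phi> x)" and ?B = "diffeo_jacobian \<phi> x"
  have "((\<lambda>x. Rep_diffeo (diffeo_inv \<phi>) (Rep_diffeo \<phi> x)) has_derivative (\<lambda>v. ?A *v (?B *v v))) (at x)"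
    by (rule has_derivative_compose[OF diffeo_has_derivative diffeo_has_derivative])
  then have "((\<lambda>x. x) has_derivative (\<lambda>v. (?A ** ?B) *v v)) (at x)"
    by (simp add: diffeo_inv_cancel matrix_vector_mul_assoc)
  from has_derivative_unique[OF this has_derivative_ident]
  have "(?A ** ?B) *v v = mat 1 *v v" for v by (auto simp: fun_eq_iff)
  then show ?thesis by (simp add: matrix_eq)
qed

lemma invertible_diffeo_jacobian: "invertible (diffeo_jacobian \<phi> x)"
  using diffeo_jacobian_inv invertible_left_inverse by blast

lemma smooth_diffeo_jacobian: "smooth_on UNIV (diffeo_jacobian \<phi>)"
proof (rule smooth_on_matrix[OF open_UNIV])
  fix i j
  show "smooth_on UNIV (\<lambda>x. diffeo_jacobian \<phi> x $ i $ j)"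
    unfolding diffeo_jacobian_def jacobian_def matrix_def
    using smooth_on_vec_nth[OF open_UNIV smooth_on_frechet_derivative[OF smooth_diffeo]] by simp
qed

lemma frame_lift_inv: "frame_lift (diffeo_inv \<phi>) (frame_lift \<phi> p) = p"
  by (cases p) (simp add: frame_lift_def diffeo_inv_cancel matrix_mul_assoc diffeo_jacobian_inv)

lemma frame_lift_in_frame_bundle: "p \<in> frame_bundle \<Longrightarrow> frame_lift \<phi> p \<in> frame_bundle"
  by (auto simp: frame_lift_def frame_bundle_def invertible_mult invertible_diffeo_jacobian)

lemma smooth_fst: "smooth_on S (f \<circ> fst)" if "smooth_on UNIV f" "open S"
  for f :: "'a::euclidean_space \<Rightarrow> 'c::real_normed_vector" and S :: "('a \<times> 'b::euclidean_space) set"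
  using smooth_on_compose[OF that(2) open_UNIV _ that(1) smooth_on_linear[OF that(2) bounded_linear_fst]]
  by (simp add: comp_def)

lemma smooth_snd: "smooth_on S snd" if "open S" for S :: "('a::euclidean_space \<times> 'b::euclidean_space) set"
  by (rule smooth_on_linear[OF that bounded_linear_snd])

lemma smooth_frame_lift: "smooth_on frame_bundle (frame_lift (\<phi> :: ('a::finite) diffeo))"
proof -
  note S = open_frame_bundle
  let ?i1 = "\<lambda>x. (x, 0) :: 'a frame" and ?i2 = "\<lambda>y. (0, y) :: 'a frame"
  have i1: "bounded_linear ?i1" and i2: "bounded_linear ?i2"
    by (intro bounded_linear_Pair bounded_linear_ident bounded_linear_zero)+
  have 1: "smooth_on frame_bundle (\<lambda>p. Rep_diffeo \<phi> (fst p))"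
    using smooth_fst[OF smooth_diffeo S] by (simp add: comp_def)
  have 2: "smooth_on frame_bundle (\<lambda>p. diffeo_jacobian \<phi> (fst p) ** snd p)"
    using smooth_on_matrix_mult[OF S smooth_fst[OF smooth_diffeo_jacobian S] smooth_snd[OF S]] by (simp add: comp_def)
  have "smooth_on frame_bundle (\<lambda>p. ?i1 (Rep_diffeo \<phi> (fst p)) + ?i2 (diffeo_jacobian \<phi> (fst p) ** snd p))"
    by (rule smooth_on_add[OF S smooth_on_linear_compose[OF S i1 1] smooth_on_linear_compose[OF S i2 2]])
  then show ?thesis by (simp add: frame_lift_def case_prod_beta')
qed

text \<open>
  \<open>\<gamma>\<^sup>i\<^sub>j\<^sub>k(\<phi>)(x, y) = (y\<^sup>-\<^sup>1 \<phi>'(x)\<^sup>-\<^sup>1 \<partial>\<^sub>\<mu>\<phi>'(x) y)\<^sup>i\<^sub>j y\<^sup>\<mu>\<^sub>k\<close>, summed over \<open>\<mu>\<close>.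
\<close>

definition frame_gamma :: "('n::finite) diffeo \<Rightarrow> 'n \<Rightarrow> 'n \<Rightarrow> 'n \<Rightarrow> 'n frame \<Rightarrow> real" where
  "frame_gamma \<phi> i j k = (\<lambda>(x, y). \<Sum>\<mu>\<in>UNIV.
     (matrix_inv y ** matrix_inv (diffeo_jacobian \<phi> x)
       ** frechet_derivative (diffeo_jacobian \<phi>) (at x) (axis \<mu> 1) ** y) $ i $ j * y $ \<mu> $ k)"

lemma smooth_frame_gamma: "smooth_on frame_bundle (frame_gamma \<phi> i j k)"
proof -
  note S = open_frame_bundle
  have 1: "smooth_on frame_bundle (\<lambda>p :: 'a frame. matrix_inv (snd p))"
    by (rule smooth_on_matrix_inv[OF S smooth_snd[OF S]]) (auto simp: frame_bundle_def)
  have 2: "smooth_on frame_bundle (\<lambda>p. matrix_inv (diffeo_jacobian \<phi> (fst p)))"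
    using smooth_on_matrix_inv[OF S smooth_fst[OF smooth_diffeo_jacobian S]]
    by (simp add: comp_def invertible_diffeo_jacobian)
  have 3: "smooth_on frame_bundle (\<lambda>p. frechet_derivative (diffeo_jacobian \<phi>) (at (fst p)) v)" for v
    using smooth_fst[OF smooth_on_frechet_derivative[OF smooth_diffeo_jacobian] S] by (simp add: comp_def)
  have "smooth_on frame_bundle (\<lambda>p. \<Sum>\<mu>\<in>UNIV.
     (matrix_inv (snd p) ** matrix_inv (diffeo_jacobian \<phi> (fst p))
       ** frechet_derivative (diffeo_jacobian \<phi>) (at (fst p)) (axis \<mu> 1) ** snd p) $ i $ j * snd p $ \<mu> $ k)"
    by (intro smooth_on_sum[OF S] smooth_on_mult[OF S] smooth_on_vec_nth[OF S] smooth_on_matrix_mult[OF S]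
        1 2 3 smooth_snd[OF S])
  then show ?thesis by (simp add: frame_gamma_def case_prod_beta')
qed

text \<open>
  Functions on the frame bundle are represented on the ambient vector space. The compact
  support lies in the frame bundle, so the extension by zero loses no information.
\<close>

definition Cc_infty :: "(('n::finite) frame \<Rightarrow> complex) set" where
  "Cc_infty = {g. smooth_on frame_bundle g \<and>
     (\<exists>K. compact K \<and> K \<subseteq> frame_bundle \<and> (\<forall>p. p \<notin> K \<longrightarrow> g p = 0))}"

lemma Cc_infty_mult_smooth:
  assumes "g \<in> Cc_infty" "smooth_on frame_bundle f"
  shows "(\<lambda>p. f p * g p) \<in> Cc_infty"
proof -
  from assms obtain K where "compact K" "K \<subseteq> frame_bundle" "\<forall>p. p \<notin> K \<longrightarrow> f p * g p = 0"
    unfolding Cc_infty_def by auto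
  moreover have "smooth_on frame_bundle (\<lambda>p. f p * g p)"
    using assms smooth_on_mult[OF open_frame_bundle] unfolding Cc_infty_def by blast
  ultimately show ?thesis unfolding Cc_infty_def by blast
qed

lemma Cc_infty_add:
  assumes "f \<in> Cc_infty" "g \<in> Cc_infty"
  shows "(\<lambda>p. f p + g p) \<in> Cc_infty"
proof -
  from assms obtain K L where "compact K" "K \<subseteq> frame_bundle" "\<forall>p. p \<notin> K \<longrightarrow> f p = 0"
    "compact L" "L \<subseteq> frame_bundle" "\<forall>p. p \<notin> L \<longrightarrow> g p = 0"
    unfolding Cc_infty_def by auto
  then have "compact (K \<union> L)" "K \<union> L \<subseteq> frame_bundle" "\<forall>p. p \<notin> K \<union> L \<longrightarrow> f p + g p = 0" by auto
  moreover have "smooth_on frame_bundle (\<lambda>p. f p + g p)"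
    using assms smooth_on_add[OF open_frame_bundle] unfolding Cc_infty_def by auto
  ultimately show ?thesis unfolding Cc_infty_def by blast
qed

lemma Cc_infty_zero: "(\<lambda>p :: ('a::finite) frame. 0) \<in> Cc_infty"
proof -
  have "compact ({} :: 'a frame set)" by simp
  then show ?thesis unfolding Cc_infty_def using smooth_on_const[OF open_frame_bundle] by blast
qed

lemma Cc_infty_scale: "g \<in> Cc_infty \<Longrightarrow> (\<lambda>p. c * g p) \<in> Cc_infty"
  by (erule Cc_infty_mult_smooth) (rule smooth_on_const[OF open_frame_bundle])

lemma Cc_infty_sum: "(\<And>i. i \<in> I \<Longrightarrow> F i \<in> Cc_infty) \<Longrightarrow> (\<lambda>p. \<Sum>i\<in>I. F i p) \<in> Cc_infty"
  by (induction I rule: infinite_finite_induct) (simp_all add: Cc_infty_zero Cc_infty_add)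

lemma Cc_infty_has_derivative:
  assumes "g \<in> Cc_infty"
  shows "(g has_derivative frechet_derivative g (at p)) (at p)"
proof (cases "p \<in> frame_bundle")
  case True
  then show ?thesis using assms smooth_on_has_derivative unfolding Cc_infty_def by blast
next
  case False
  from assms obtain K where K: "compact K" "K \<subseteq> frame_bundle" "\<forall>p. p \<notin> K \<longrightarrow> g p = 0"
    unfolding Cc_infty_def by auto
  then have "(g has_derivative (\<lambda>v. 0)) (at p)"
    using False by (intro has_derivative_transform_within_open[OF has_derivative_const[of 0], where s = "- K"])
      (auto simp: compact_imp_closed open_Compl)
  then show ?thesis using frechet_derivative_at by metis
qed

lemma Cc_infty_derivative:
  assumes "g \<in> Cc_infty"
  shows "(\<lambda>p. frechet_derivative g (at p) v) \<in> Cc_infty"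
proof -
  from assms obtain K where K: "compact K" "K \<subseteq> frame_bundle" "\<forall>p. p \<notin> K \<longrightarrow> g p = 0"
    unfolding Cc_infty_def by auto
  have "frechet_derivative g (at p) v = 0" if "p \<notin> K" for p
  proof -
    have "(g has_derivative (\<lambda>v. 0)) (at p)"
      using that K by (intro has_derivative_transform_within_open[OF has_derivative_const[of 0], where s = "- K"])
        (auto simp: compact_imp_closed open_Compl)
    then show ?thesis using frechet_derivative_at by metis
  qed
  moreover have "smooth_on frame_bundle (\<lambda>p. frechet_derivative g (at p) v)"
    using assms smooth_on_frechet_derivative unfolding Cc_infty_def by blast
  ultimately show ?thesis using K unfolding Cc_infty_def by blast
qed

lemma smooth_of_real:
  assumes "open S" "smooth_on S f"
  shows "smooth_on S (\<lambda>p. complex_of_real (f p))"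
  using smooth_on_linear_compose[OF assms(1) bounded_linear_of_real assms(2)] .

lemma Cc_infty_pullback:
  assumes "g \<in> Cc_infty"
  shows "(\<lambda>p. g (frame_lift \<phi> p)) \<in> Cc_infty"
proof -
  from assms obtain K where K: "compact K" "K \<subseteq> frame_bundle" "\<forall>p. p \<notin> K \<longrightarrow> g p = 0"
    and g: "smooth_on frame_bundle g" unfolding Cc_infty_def by auto
  let ?K = "frame_lift (diffeo_inv \<phi>) ` K"
  have "continuous_on K (frame_lift (diffeo_inv \<phi>))"
    using smooth_on_continuous_on[OF smooth_frame_lift] K(2) continuous_on_subset by blast
  then have "compact ?K" using K(1) by (rule compact_continuous_image)
  moreover have "?K \<subseteq> frame_bundle" using K(2) frame_lift_in_frame_bundle by blast
  moreover have "\<forall>p. p \<notin> ?K \<longrightarrow> g (frame_lift \<phi> p) = 0"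
    using K(3) frame_lift_inv by (metis image_eqI)
  moreover have "smooth_on frame_bundle (\<lambda>p. g (frame_lift \<phi> p))"
    using frame_lift_in_frame_bundle
    by (intro smooth_on_compose[OF open_frame_bundle open_frame_bundle _ g smooth_frame_lift]) blast
  ultimately show ?thesis unfolding Cc_infty_def by blast
qed

class scaleC =
  fixes scaleC :: "complex \<Rightarrow> 'a \<Rightarrow> 'a" (infixr "*\<^sub>C" 75)

class complex_vector = scaleC + ab_group_add +
  assumes scaleC_add_right: "a *\<^sub>C (x + y) = a *\<^sub>C x + a *\<^sub>C y"
    and scaleC_add_left: "(a + b) *\<^sub>C x = a *\<^sub>C x + b *\<^sub>C x"
    and scaleC_scaleC: "a *\<^sub>C b *\<^sub>C x = (a * b) *\<^sub>C x"
    and scaleC_one: "1 *\<^sub>C x = x"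

text \<open>
  Unital associative complex algebras, the zero algebra included.
\<close>

class complex_algebra = complex_vector + ring + monoid_mult +
  assumes mult_scaleC_left: "(a *\<^sub>C x) * y = a *\<^sub>C (x * y)"
    and mult_scaleC_right: "x * (a *\<^sub>C y) = a *\<^sub>C (x * y)"

global_interpretation complex_vector: vector_space "scaleC :: complex \<Rightarrow> 'a::complex_vector \<Rightarrow> 'a"
  by unfold_locales (simp_all add: scaleC_add_right scaleC_add_left scaleC_scaleC scaleC_one)

abbreviation cspan :: "'a::complex_vector set \<Rightarrow> 'a set" where
  "cspan \<equiv> module.span scaleC"

abbreviation clinear :: "('a::complex_vector \<Rightarrow> 'b::complex_vector) \<Rightarrow> bool" where
  "clinear \<equiv> Vector_Spaces.linear scaleC scaleC"

lemma clinear_iff: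
  "clinear f \<longleftrightarrow> (\<forall>x y. f (x + y) = f x + f y) \<and> (\<forall>c x. f (c *\<^sub>C x) = c *\<^sub>C f x)"
  by (auto simp: Vector_Spaces.linear_def module_hom_def module_hom_axioms_def
      complex_vector.vector_space_axioms complex_vector.module_axioms)

instantiation complex :: complex_vector
begin
definition "scaleC_complex (a :: complex) (x :: complex) = a * x"
instance by intro_classes (simp_all add: scaleC_complex_def algebra_simps)
end

instantiation poly_mapping :: (type, complex_vector) complex_vector
begin
definition "scaleC_poly_mapping (a :: complex) (u :: 'a \<Rightarrow>\<^sub>0 'b) = Poly_Mapping.map (scaleC a) u"

lemma lookup_scaleC: "Poly_Mapping.lookup (a *\<^sub>C (u :: 'a \<Rightarrow>\<^sub>0 'b)) k = a *\<^sub>C Poly_Mapping.lookup u k"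
  unfolding scaleC_poly_mapping_def
  by (simp add: Poly_Mapping.map.rep_eq when_def)

instance
  by intro_classes (auto intro!: poly_mapping_eqI
      simp: lookup_scaleC lookup_add scaleC_add_right scaleC_add_left scaleC_scaleC scaleC_one)
end

typedef ('n::finite) ccfun = "Cc_infty :: ('n frame \<Rightarrow> complex) set"
  using Cc_infty_zero by blast

setup_lifting type_definition_ccfun

instantiation ccfun :: (finite) "{complex_vector, comm_ring}"
begin
lift_definition zero_ccfun :: "'a ccfun" is "\<lambda>p. 0" by (rule Cc_infty_zero)
lift_definition plus_ccfun :: "'a ccfun \<Rightarrow> 'a ccfun \<Rightarrow> 'a ccfun" is "\<lambda>f g p. f p + g p"
  by (rule Cc_infty_add)
lift_definition scaleC_ccfun :: "complex \<Rightarrow> 'a ccfun \<Rightarrow> 'a ccfun" is "\<lambda>c g p. c * g p"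
  by (rule Cc_infty_scale)
lift_definition uminus_ccfun :: "'a ccfun \<Rightarrow> 'a ccfun" is "\<lambda>g p. - g p"
  using Cc_infty_scale[of _ "-1"] by simp
lift_definition minus_ccfun :: "'a ccfun \<Rightarrow> 'a ccfun \<Rightarrow> 'a ccfun" is "\<lambda>f g p. f p - g p"
  using Cc_infty_add[OF _ Cc_infty_scale[of _ "-1"]] by simp
lift_definition times_ccfun :: "'a ccfun \<Rightarrow> 'a ccfun \<Rightarrow> 'a ccfun" is "\<lambda>f g p. f p * g p"
  by (rule Cc_infty_mult_smooth) (simp_all add: Cc_infty_def)
instance
  by intro_classes (transfer; simp add: algebra_simps fun_eq_iff)+
end

lift_definition ccfun_pullback :: "('n::finite) diffeo \<Rightarrow> 'n ccfun \<Rightarrow> 'n ccfun" is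
  "\<lambda>\<phi> g p. g (frame_lift \<phi> p)" by (rule Cc_infty_pullback)

text \<open>
  \<open>X\<^sub>k = y\<^sup>\<mu>\<^sub>k \<partial>/\<partial>x\<^sup>\<mu>\<close> and \<open>Y\<^sub>i\<^sup>j = y\<^sup>\<mu>\<^sub>i \<partial>/\<partial>y\<^sup>\<mu>\<^sub>j\<close> on functions; in \<open>ccfun_Y i j\<close>, \<open>i\<close> is the
  lower and \<open>j\<close> the upper index.
\<close>

lift_definition ccfun_X :: "'n \<Rightarrow> ('n::finite) ccfun \<Rightarrow> 'n ccfun" is
  "\<lambda>k g (x, y). \<Sum>\<mu>\<in>UNIV. complex_of_real (y $ \<mu> $ k) * frechet_derivative g (at (x, y)) (axis \<mu> 1, 0)"
proof -
  fix k :: 'n and g :: "'n frame \<Rightarrow> complex"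
  assume g: "g \<in> Cc_infty"
  have "(\<lambda>p. \<Sum>\<mu>\<in>UNIV. complex_of_real (snd p $ \<mu> $ k) * frechet_derivative g (at p) (axis \<mu> 1, 0)) \<in> Cc_infty"
    by (intro Cc_infty_sum Cc_infty_mult_smooth Cc_infty_derivative g smooth_of_real[OF open_frame_bundle]
        smooth_on_vec_nth[OF open_frame_bundle] smooth_snd[OF open_frame_bundle])
  then show "(\<lambda>(x, y). \<Sum>\<mu>\<in>UNIV. complex_of_real (y $ \<mu> $ k) * frechet_derivative g (at (x, y)) (axis \<mu> 1, 0)) \<in> Cc_infty"
    by (simp add: case_prod_beta')
qed

lift_definition ccfun_Y :: "'n \<Rightarrow> 'n \<Rightarrow> ('n::finite) ccfun \<Rightarrow> 'n ccfun" is
  "\<lambda>i j g (x, y). \<Sum>\<mu>\<in>UNIV. complex_of_real (y $ \<mu> $ i) *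
     frechet_derivative g (at (x, y)) (0, axis \<mu> (axis j 1))"
proof -
  fix i j :: 'n and g :: "'n frame \<Rightarrow> complex"
  assume g: "g \<in> Cc_infty"
  have "(\<lambda>p. \<Sum>\<mu>\<in>UNIV. complex_of_real (snd p $ \<mu> $ i) * frechet_derivative g (at p) (0, axis \<mu> (axis j 1))) \<in> Cc_infty"
    by (intro Cc_infty_sum Cc_infty_mult_smooth Cc_infty_derivative g smooth_of_real[OF open_frame_bundle]
        smooth_on_vec_nth[OF open_frame_bundle] smooth_snd[OF open_frame_bundle])
  then show "(\<lambda>(x, y). \<Sum>\<mu>\<in>UNIV. complex_of_real (y $ \<mu> $ i) *
     frechet_derivative g (at (x, y)) (0, axis \<mu> (axis j 1))) \<in> Cc_infty"
    by (simp add: case_prod_beta')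
qed

lift_definition ccfun_gamma :: "('n::finite) diffeo \<Rightarrow> 'n \<Rightarrow> 'n \<Rightarrow> 'n \<Rightarrow> 'n ccfun \<Rightarrow> 'n ccfun" is
  "\<lambda>\<phi> i j k g p. complex_of_real (frame_gamma \<phi> i j k p) * g p"
  by (erule Cc_infty_mult_smooth) (rule smooth_of_real[OF open_frame_bundle smooth_frame_gamma])

lemma ccfun_frechet_add:
  "frechet_derivative (\<lambda>p. Rep_ccfun f p + Rep_ccfun g p) (at p) v =
   frechet_derivative (Rep_ccfun f) (at p) v + frechet_derivative (Rep_ccfun g) (at p) v"
  using frechet_derivative_at[OF has_derivative_add[OF Cc_infty_has_derivative Cc_infty_has_derivative], OF Rep_ccfun Rep_ccfun, of f p g]
  by (metis (no_types, lifting))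

lemma ccfun_frechet_scale:
  "frechet_derivative (\<lambda>p. c * Rep_ccfun g p) (at p) v = c * frechet_derivative (Rep_ccfun g) (at p) v"
  using frechet_derivative_at[OF has_derivative_mult_right[OF Cc_infty_has_derivative], OF Rep_ccfun, of c g p]
  by (metis (no_types, lifting))

lemma clinear_ccfun_X: "clinear (ccfun_X k)"
  unfolding clinear_iff Rep_ccfun_inject[symmetric]
  by (auto simp: ccfun_X.rep_eq plus_ccfun.rep_eq scaleC_ccfun.rep_eq ccfun_frechet_add ccfun_frechet_scale
      fun_eq_iff algebra_simps sum.distrib sum_distrib_left)

lemma clinear_ccfun_Y: "clinear (ccfun_Y i j)"
  unfolding clinear_iff Rep_ccfun_inject[symmetric]
  by (auto simp: ccfun_Y.rep_eq plus_ccfun.rep_eq scaleC_ccfun.rep_eq ccfun_frechet_add ccfun_frechet_scale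
      fun_eq_iff algebra_simps sum.distrib sum_distrib_left)

lemma clinear_ccfun_gamma: "clinear (ccfun_gamma \<phi> i j k)"
  unfolding clinear_iff Rep_ccfun_inject[symmetric]
  by (auto simp: ccfun_gamma.rep_eq plus_ccfun.rep_eq scaleC_ccfun.rep_eq fun_eq_iff algebra_simps)

text \<open>
  An element \<open>\<Sum> g\<^sub>\<phi> U\<^sub>\<phi>\<^sup>*\<close> of the crossed product is the finitely supported family \<open>\<phi> \<mapsto> g\<^sub>\<phi>\<close>, and
  \<open>g U\<^sub>\<phi>\<^sup>*\<close> is \<open>Poly_Mapping.single \<phi> g\<close>. The product is
  \<open>(f U\<^sub>\<phi>\<^sup>*) (g U\<^sub>\<psi>\<^sup>*) = f (g \<circ> \<phi>\<^sup>~) U\<^sub>\<psi>\<^sub>\<phi>\<^sup>*\<close> with \<open>\<phi>\<^sup>~ = frame_lift \<phi>\<close>, which is the convention for which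
  \<open>X\<^sub>k(ab) = X\<^sub>k(a) b + a X\<^sub>k(b) + \<Sum>\<^sub>i\<^sub>,\<^sub>j \<delta>\<^sup>i\<^sub>j\<^sub>k(a) Y\<^sub>i\<^sup>j(b)\<close>. It is not an instance of \<open>times\<close>, since the
  library reserves that class on finitely supported functions for convolution over an additive monoid.
\<close>

type_synonym 'n crossed = "'n diffeo \<Rightarrow>\<^sub>0 'n ccfun"

definition crossed_mult :: "('n::finite) crossed \<Rightarrow> 'n crossed \<Rightarrow> 'n crossed" (infixl "\<rtimes>\<^sub>*" 70) where
  "a \<rtimes>\<^sub>* b = (\<Sum>\<phi>\<in>Poly_Mapping.keys a. \<Sum>\<psi>\<in>Poly_Mapping.keys b.
     Poly_Mapping.single (diffeo_comp \<psi> \<phi>) (Poly_Mapping.lookup a \<phi> * ccfun_pullback \<phi> (Poly_Mapping.lookup b \<psi>)))"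

definition op_X :: "'n \<Rightarrow> ('n::finite) crossed \<Rightarrow> 'n crossed" where
  "op_X k = Poly_Mapping.mapp (\<lambda>\<phi>. ccfun_X k)"

definition op_Y :: "'n \<Rightarrow> 'n \<Rightarrow> ('n::finite) crossed \<Rightarrow> 'n crossed" where
  "op_Y i j = Poly_Mapping.mapp (\<lambda>\<phi>. ccfun_Y i j)"

definition op_delta :: "'n \<Rightarrow> 'n \<Rightarrow> 'n \<Rightarrow> ('n::finite) crossed \<Rightarrow> 'n crossed" where
  "op_delta i j k = Poly_Mapping.mapp (\<lambda>\<phi>. ccfun_gamma \<phi> i j k)"

lemma clinear_mapp:
  assumes "\<And>\<phi>. clinear (F \<phi>)"
  shows "clinear (Poly_Mapping.mapp F)"
proof -
  have F: "F \<phi> (x + y) = F \<phi> x + F \<phi> y" "F \<phi> (c *\<^sub>C x) = c *\<^sub>C F \<phi> x" for \<phi> x y c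
    using assms[of \<phi>] by (auto simp: clinear_iff)
  have "F \<phi> 0 = 0" for \<phi>
    using F(2)[of \<phi> 0 0] by simp
  then have "Poly_Mapping.lookup (Poly_Mapping.mapp F u) \<phi> = F \<phi> (Poly_Mapping.lookup u \<phi>)" for u \<phi>
    by (simp add: lookup_mapp when_def in_keys_iff)
  then show ?thesis
    unfolding clinear_iff by (auto intro!: poly_mapping_eqI simp: lookup_add lookup_scaleC F)
qed

inductive_set connes_moscovici_ops :: "(('n::finite) crossed \<Rightarrow> 'n crossed) set" where
  "op_X k \<in> connes_moscovici_ops"
| "op_Y i j \<in> connes_moscovici_ops"
| "op_delta i j k \<in> connes_moscovici_ops"
| "(\<lambda>a. a) \<in> connes_moscovici_ops"
| "S \<in> connes_moscovici_ops \<Longrightarrow> T \<in> connes_moscovici_ops \<Longrightarrow> (\<lambda>a. S a + T a) \<in> connes_moscovici_ops"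
| "S \<in> connes_moscovici_ops \<Longrightarrow> (\<lambda>a. c *\<^sub>C S a) \<in> connes_moscovici_ops"
| "S \<in> connes_moscovici_ops \<Longrightarrow> T \<in> connes_moscovici_ops \<Longrightarrow> (\<lambda>a. S (T a)) \<in> connes_moscovici_ops"

lemma clinear_connes_moscovici_ops: "S \<in> connes_moscovici_ops \<Longrightarrow> clinear S"
proof (induction rule: connes_moscovici_ops.induct)
  case (1 k)
  then show ?case unfolding op_X_def by (rule clinear_mapp) (rule clinear_ccfun_X)
next
  case (2 i j)
  then show ?case unfolding op_Y_def by (rule clinear_mapp) (rule clinear_ccfun_Y)
next
  case (3 i j k)
  then show ?case unfolding op_delta_def by (rule clinear_mapp) (rule clinear_ccfun_gamma)
qed (auto simp: clinear_iff scaleC_add_right scaleC_scaleC mult.commute)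

typedef 'n connes_moscovici = "connes_moscovici_ops :: (('n::finite) crossed \<Rightarrow> 'n crossed) set"
  using connes_moscovici_ops.intros(4) by blast

setup_lifting type_definition_connes_moscovici

instantiation connes_moscovici :: (finite) complex_algebra
begin
lift_definition zero_connes_moscovici :: "'a connes_moscovici" is "\<lambda>a. 0"
  using connes_moscovici_ops.intros(6)[OF connes_moscovici_ops.intros(4), of 0] by simp
lift_definition one_connes_moscovici :: "'a connes_moscovici" is "\<lambda>a. a"
  by (rule connes_moscovici_ops.intros)
lift_definition plus_connes_moscovici :: "'a connes_moscovici \<Rightarrow> 'a connes_moscovici \<Rightarrow> 'a connes_moscovici"
  is "\<lambda>S T a. S a + T a" by (rule connes_moscovici_ops.intros)
lift_definition scaleC_connes_moscovici :: "complex \<Rightarrow> 'a connes_moscovici \<Rightarrow> 'a connes_moscovici"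
  is "\<lambda>c S a. c *\<^sub>C S a" by (rule connes_moscovici_ops.intros)
lift_definition uminus_connes_moscovici :: "'a connes_moscovici \<Rightarrow> 'a connes_moscovici" is "\<lambda>S a. - S a"
  using connes_moscovici_ops.intros(6)[of _ "-1"] by simp
lift_definition minus_connes_moscovici :: "'a connes_moscovici \<Rightarrow> 'a connes_moscovici \<Rightarrow> 'a connes_moscovici"
  is "\<lambda>S T a. S a - T a"
  using connes_moscovici_ops.intros(5)[OF _ connes_moscovici_ops.intros(6)[of _ "-1"]] by simp
lift_definition times_connes_moscovici :: "'a connes_moscovici \<Rightarrow> 'a connes_moscovici \<Rightarrow> 'a connes_moscovici"
  is "\<lambda>S T a. S (T a)" by (rule connes_moscovici_ops.intros)
instance
proof
  fix a b c :: "'a connes_moscovici" and r s :: complex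
  show "a + b + c = a + (b + c)" "a + b = b + a" "0 + a = a" "- a + a = 0" "a - b = a + - b"
    "a * b * c = a * (b * c)" "1 * a = a" "a * 1 = a" "(a + b) * c = a * c + b * c"
    "r *\<^sub>C (a + b) = r *\<^sub>C a + r *\<^sub>C b" "(r + s) *\<^sub>C a = r *\<^sub>C a + s *\<^sub>C a"
    "r *\<^sub>C s *\<^sub>C a = (r * s) *\<^sub>C a" "1 *\<^sub>C a = a" "(r *\<^sub>C a) * b = r *\<^sub>C (a * b)"
    by (transfer; simp add: fun_eq_iff algebra_simps scaleC_add_right scaleC_add_left scaleC_scaleC scaleC_one)+
  show "a * (b + c) = a * b + a * c" "a * (r *\<^sub>C b) = r *\<^sub>C (a * b)"
    by (transfer; drule clinear_connes_moscovici_ops; simp add: clinear_iff fun_eq_iff)+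
qed
end

text \<open>
  The tensor product over the complex numbers: the free vector space on pairs modulo the span
  of the bilinearity relations.
\<close>

definition bilinear_relations :: "(('v::complex_vector \<times> 'w::complex_vector) \<Rightarrow>\<^sub>0 complex) set" where
  "bilinear_relations =
     {Poly_Mapping.single (v + v', w) 1 - Poly_Mapping.single (v, w) 1 - Poly_Mapping.single (v', w) 1 | v v' w. True}
   \<union> {Poly_Mapping.single (v, w + w') 1 - Poly_Mapping.single (v, w) 1 - Poly_Mapping.single (v, w') 1 | v w w'. True}
   \<union> {Poly_Mapping.single (c *\<^sub>C v, w) 1 - c *\<^sub>C Poly_Mapping.single (v, w) 1 | c v w. True}
   \<union> {Poly_Mapping.single (v, c *\<^sub>C w) 1 - c *\<^sub>C Poly_Mapping.single (v, w) 1 | c v w. True}"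

definition tensor_eq :: "(('v::complex_vector \<times> 'w::complex_vector) \<Rightarrow>\<^sub>0 complex) \<Rightarrow> (('v \<times> 'w) \<Rightarrow>\<^sub>0 complex) \<Rightarrow> bool" where
  "tensor_eq s t \<longleftrightarrow> s - t \<in> cspan bilinear_relations"

lemma equivp_tensor_eq:
  "equivp (tensor_eq :: (('a::complex_vector \<times> 'b::complex_vector) \<Rightarrow>\<^sub>0 complex) \<Rightarrow> _)"
proof (rule equivpI[OF reflpI sympI transpI])
  fix x y z :: "('a \<times> 'b) \<Rightarrow>\<^sub>0 complex"
  show "tensor_eq x x" by (simp add: tensor_eq_def complex_vector.span_zero)
  show "tensor_eq y x" if "tensor_eq x y"
    using complex_vector.span_neg[OF that[unfolded tensor_eq_def]] by (simp add: tensor_eq_def)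
  show "tensor_eq x z" if "tensor_eq x y" "tensor_eq y z"
    using complex_vector.span_add[OF that[unfolded tensor_eq_def]] by (simp add: tensor_eq_def)
qed

quotient_type (overloaded) ('v, 'w) tensor = "('v::complex_vector \<times> 'w::complex_vector) \<Rightarrow>\<^sub>0 complex" / tensor_eq
  by (rule equivp_tensor_eq)

instantiation tensor :: (complex_vector, complex_vector) complex_vector
begin
lift_definition zero_tensor :: "('a, 'b) tensor" is 0 .
lift_definition plus_tensor :: "('a, 'b) tensor \<Rightarrow> ('a, 'b) tensor \<Rightarrow> ('a, 'b) tensor" is "(+)"
  unfolding tensor_eq_def add_diff_add by (rule complex_vector.span_add)
lift_definition uminus_tensor :: "('a, 'b) tensor \<Rightarrow> ('a, 'b) tensor" is uminus
  unfolding tensor_eq_def minus_diff_minus by (rule complex_vector.span_neg)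
lift_definition minus_tensor :: "('a, 'b) tensor \<Rightarrow> ('a, 'b) tensor \<Rightarrow> ('a, 'b) tensor" is "(-)"
proof -
  fix a b c d :: "('a \<times> 'b) \<Rightarrow>\<^sub>0 complex"
  assume "tensor_eq a b" "tensor_eq c d"
  then have "(a - b) - (c - d) \<in> cspan bilinear_relations"
    unfolding tensor_eq_def by (rule complex_vector.span_diff)
  then show "tensor_eq (a - c) (b - d)" unfolding tensor_eq_def by (simp add: algebra_simps)
qed
lift_definition scaleC_tensor :: "complex \<Rightarrow> ('a, 'b) tensor \<Rightarrow> ('a, 'b) tensor" is scaleC
  unfolding tensor_eq_def complex_vector.scale_right_diff_distrib[symmetric] by (rule complex_vector.span_scale)
instance
proof
  fix a b c :: "('a, 'b) tensor" and r s :: complex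
  show "a + b + c = a + (b + c)" "a + b = b + a" "0 + a = a" "- a + a = 0" "a - b = a + - b"
    "r *\<^sub>C (a + b) = r *\<^sub>C a + r *\<^sub>C b" "(r + s) *\<^sub>C a = r *\<^sub>C a + s *\<^sub>C a"
    "r *\<^sub>C s *\<^sub>C a = (r * s) *\<^sub>C a" "1 *\<^sub>C a = a"
    by (transfer; simp add: tensor_eq_def complex_vector.span_zero scaleC_add_right scaleC_add_left
        scaleC_scaleC scaleC_one add.commute add.left_commute)+
qed
end

lift_definition pure_tensor :: "'v::complex_vector \<Rightarrow> 'w::complex_vector \<Rightarrow> ('v, 'w) tensor" (infix "\<otimes>\<^sub>C" 75)
  is "\<lambda>v w. Poly_Mapping.single (v, w) 1" .

text \<open>
  The linear map out of the tensor product induced by a bilinear \<open>\<beta>\<close>. The chosen representative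
  is immaterial exactly when \<open>\<beta>\<close> is bilinear; the universal property is proved below.
\<close>

definition tensor_lift :: "('v::complex_vector \<Rightarrow> 'w::complex_vector \<Rightarrow> 'u::complex_vector) \<Rightarrow> ('v, 'w) tensor \<Rightarrow> 'u" where
  "tensor_lift \<beta> t = (\<Sum>(v, w)\<in>Poly_Mapping.keys (rep_tensor t). Poly_Mapping.lookup (rep_tensor t) (v, w) *\<^sub>C \<beta> v w)"

definition cbilinear :: "('v::complex_vector \<Rightarrow> 'w::complex_vector \<Rightarrow> 'u::complex_vector) \<Rightarrow> bool" where
  "cbilinear \<beta> \<longleftrightarrow> (\<forall>v. clinear (\<beta> v)) \<and> (\<forall>w. clinear (\<lambda>v. \<beta> v w))"

context
  fixes \<beta> :: "'v::complex_vector \<Rightarrow> 'w::complex_vector \<Rightarrow> 'u::complex_vector"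
  assumes bil: "cbilinear \<beta>"
begin

private definition ext :: "(('v \<times> 'w) \<Rightarrow>\<^sub>0 complex) \<Rightarrow> 'u" where
  "ext u = (\<Sum>p\<in>Poly_Mapping.keys u. Poly_Mapping.lookup u p *\<^sub>C \<beta> (fst p) (snd p))"

private lemma ext_superset:
  "finite F \<Longrightarrow> Poly_Mapping.keys u \<subseteq> F \<Longrightarrow> ext u = (\<Sum>p\<in>F. Poly_Mapping.lookup u p *\<^sub>C \<beta> (fst p) (snd p))"
  unfolding ext_def by (intro sum.mono_neutral_left) (auto simp: in_keys_iff)

private lemma clinear_ext: "clinear ext"
proof -
  have "ext (u + v) = ext u + ext v" for u v
  proof -
    let ?F = "Poly_Mapping.keys u \<union> Poly_Mapping.keys v"
    have "ext (u + v) = (\<Sum>p\<in>?F. Poly_Mapping.lookup (u + v) p *\<^sub>C \<beta> (fst p) (snd p))"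
      using Poly_Mapping.keys_add[of u v] by (intro ext_superset) auto
    also have "\<dots> = ext u + ext v"
      by (simp add: ext_superset[of ?F] lookup_add scaleC_add_left sum.distrib)
    finally show ?thesis .
  qed
  moreover have "ext (c *\<^sub>C u) = c *\<^sub>C ext u" for c u
  proof -
    have "Poly_Mapping.keys (c *\<^sub>C u) \<subseteq> Poly_Mapping.keys u"
      by (auto simp: in_keys_iff lookup_scaleC)
    then show ?thesis
      by (simp add: ext_superset[of "Poly_Mapping.keys u"] lookup_scaleC complex_vector.scale_sum_right
          scaleC_scaleC scaleC_complex_def)
  qed
  ultimately show ?thesis by (simp add: clinear_iff)
qed

private lemma ext_single: "ext (Poly_Mapping.single (v, w) 1) = \<beta> v w"
  by (simp add: ext_def scaleC_one)

private lemma ext_relations: "u \<in> cspan bilinear_relations \<Longrightarrow> ext u = 0"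
proof (induction rule: complex_vector.span_induct_alt)
  case base
  show ?case by (simp add: ext_def)
next
  case (step c x y)
  have lin: "ext (a + b) = ext a + ext b" "ext (r *\<^sub>C a) = r *\<^sub>C ext a" for a b r
    using clinear_ext by (auto simp: clinear_iff)
  have sub: "ext (a - b) = ext a - ext b" for a b
    using lin(1)[of "a - b" b] by simp
  have "ext x = 0"
    using step(1) bil unfolding bilinear_relations_def
    by (auto simp: sub lin ext_single cbilinear_def clinear_iff)
  then show ?case using step by (simp add: lin)
qed

private lemma tensor_lift_eq_ext: "tensor_lift \<beta> (abs_tensor u) = ext u"
proof -
  have "tensor_eq (rep_tensor (abs_tensor u)) u"
    by (rule Quotient3_rep_abs[OF Quotient3_tensor]) (simp add: equivp_reflp[OF equivp_tensor_eq])
  then have "ext (rep_tensor (abs_tensor u) - u) = 0"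
    by (simp add: tensor_eq_def ext_relations)
  then have "ext (rep_tensor (abs_tensor u)) = ext u"
    using clinear_ext[unfolded clinear_iff, THEN conjunct1, rule_format, of "rep_tensor (abs_tensor u) - u" u] by simp
  then show ?thesis by (simp add: tensor_lift_def ext_def case_prod_beta')
qed

lemma tensor_lift_pure: "tensor_lift \<beta> (v \<otimes>\<^sub>C w) = \<beta> v w"
  unfolding pure_tensor.abs_eq tensor_lift_eq_ext by (rule ext_single)

lemma clinear_tensor_lift: "clinear (tensor_lift \<beta>)"
  unfolding clinear_iff
proof (intro conjI allI)
  fix x y :: "('v, 'w) tensor" and c
  obtain u v where "x = abs_tensor u" "y = abs_tensor v"
    using Quotient3_abs_rep[OF Quotient3_tensor] by metis
  then show "tensor_lift \<beta> (x + y) = tensor_lift \<beta> x + tensor_lift \<beta> y"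
    and "tensor_lift \<beta> (c *\<^sub>C x) = c *\<^sub>C tensor_lift \<beta> x"
    using clinear_ext by (auto simp: plus_tensor.abs_eq scaleC_tensor.abs_eq tensor_lift_eq_ext clinear_iff)
qed

end

definition tensor_map :: "('v \<Rightarrow> 'v') \<Rightarrow> ('w \<Rightarrow> 'w') \<Rightarrow>
    ('v::complex_vector, 'w::complex_vector) tensor \<Rightarrow> ('v'::complex_vector, 'w'::complex_vector) tensor" where
  "tensor_map f g = tensor_lift (\<lambda>v w. f v \<otimes>\<^sub>C g w)"

definition tensor_assoc :: "(('u::complex_vector, 'v::complex_vector) tensor, 'w::complex_vector) tensor
    \<Rightarrow> ('u, ('v, 'w) tensor) tensor" where
  "tensor_assoc = tensor_lift (\<lambda>t w. tensor_lift (\<lambda>u v. u \<otimes>\<^sub>C (v \<otimes>\<^sub>C w)) t)"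

definition tensor_mult :: "('a::complex_algebra, 'b::complex_algebra) tensor \<Rightarrow> ('a, 'b) tensor \<Rightarrow> ('a, 'b) tensor" where
  "tensor_mult s t = tensor_lift (\<lambda>a b. tensor_lift (\<lambda>a' b'. (a * a') \<otimes>\<^sub>C (b * b')) t) s"

definition cm_apply :: "('n::finite) connes_moscovici \<Rightarrow> 'n crossed \<Rightarrow> 'n crossed" where
  "cm_apply = Rep_connes_moscovici"

text \<open>
  The coproduct is the element \<open>h\<^sup>(\<^sup>1\<^sup>) \<otimes> h\<^sup>(\<^sup>2\<^sup>)\<close> with \<open>h(ab) = h\<^sup>(\<^sup>1\<^sup>)(a) h\<^sup>(\<^sup>2\<^sup>)(b)\<close>. It exists by the product
  rules for the generators: \<open>Y\<^sub>i\<^sup>j\<close> and \<open>\<delta>\<^sup>i\<^sub>j\<^sub>k\<close> are derivations, \<open>X\<^sub>k\<close> obeys the formula above. It is unique: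
  the lifts of the affine group act transitively on the frame bundle and leave \<open>\<gamma>\<close> unchanged under
  \<open>\<phi> \<mapsto> \<theta> \<circ> \<phi>\<close>, so the two factors of \<open>h\<^sub>1(f U\<^sub>\<phi>\<^sup>*)(p) h\<^sub>2(g U\<^sub>\<psi>\<^sup>*)(\<phi>\<^sup>~(p))\<close> can be varied independently.
\<close>

definition cm_comult :: "('n::finite) connes_moscovici \<Rightarrow> ('n connes_moscovici, 'n connes_moscovici) tensor" where
  "cm_comult h = (THE t. \<forall>a b. cm_apply h (a \<rtimes>\<^sub>* b) =
     tensor_lift (\<lambda>h1 h2. cm_apply h1 a \<rtimes>\<^sub>* cm_apply h2 b) t)"

text \<open>
  The counit is given by \<open>h(1) = \<epsilon>(h) 1\<close>. The crossed product has no unit, as the constant function 1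
  is not compactly supported. The operators \<open>h\<close> are local, so \<open>h(1)\<close> is computed at a point \<open>p\<close> by
  replacing 1 with any \<open>g U\<^sub>i\<^sub>d\<^sup>*\<close> such that \<open>g = 1\<close> near \<open>p\<close>.
\<close>

definition cm_counit :: "('n::finite) connes_moscovici \<Rightarrow> complex" where
  "cm_counit h = (THE c. \<forall>g p. (\<forall>\<^sub>F q in nhds p. Rep_ccfun g q = 1) \<longrightarrow>
     (\<forall>\<phi>. Rep_ccfun (Poly_Mapping.lookup (cm_apply h (Poly_Mapping.single diffeo_id g)) \<phi>) p =
       c * Rep_ccfun (Poly_Mapping.lookup (Poly_Mapping.single diffeo_id g) \<phi>) p))"

text \<open>
  Coassociativity and counitality of the coaction \<open>\<rho>\<close>, and the condition that \<open>\<rho>\<close> is a homomorphism of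
  unital algebras.
\<close>

definition right_comodule_algebra ::
  "('h::complex_algebra \<Rightarrow> ('h, 'h) tensor) \<Rightarrow> ('h \<Rightarrow> complex) \<Rightarrow> ('a::complex_algebra \<Rightarrow> ('a, 'h) tensor) \<Rightarrow> bool" where
  "right_comodule_algebra \<Delta> \<epsilon> \<rho> \<longleftrightarrow>
     clinear \<rho> \<and>
     (\<forall>a. tensor_assoc (tensor_map \<rho> id (\<rho> a)) = tensor_map id \<Delta> (\<rho> a)) \<and>
     (\<forall>a. tensor_lift (\<lambda>x h. \<epsilon> h *\<^sub>C x) (\<rho> a) = a) \<and>
     (\<forall>a b. \<rho> (a * b) = tensor_mult (\<rho> a) (\<rho> b)) \<and>
     \<rho> 1 = 1 \<otimes>\<^sub>C 1"

definition coinvariants :: "('a::complex_algebra \<Rightarrow> ('a, 'h::complex_algebra) tensor) \<Rightarrow> 'a set" where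
  "coinvariants \<rho> = {a. \<rho> a = a \<otimes>\<^sub>C 1}"

text \<open>
  The elements of \<open>A \<otimes>\<^sub>B A\<close> are the cosets in \<open>A \<otimes> A\<close> of the span of all \<open>ab \<otimes> a' - a \<otimes> ba'\<close>
  with \<open>b \<in> B\<close>.
\<close>

definition balanced_relations :: "'a set \<Rightarrow> ('a::complex_algebra, 'a) tensor set" where
  "balanced_relations B = {(a * b) \<otimes>\<^sub>C a' - a \<otimes>\<^sub>C (b * a') | a b a'. b \<in> B}"

definition balanced_tensor :: "'a set \<Rightarrow> ('a::complex_algebra, 'a) tensor set set" where
  "balanced_tensor B = UNIV // {(s, t). s - t \<in> cspan (balanced_relations B)}"

text \<open>
  \<open>a \<otimes> a' \<mapsto> a a'\<^sub>0 \<otimes> a'\<^sub>1\<close> on \<open>A \<otimes> A\<close>. For a comodule algebra it is constant on the cosets that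
  form \<open>A \<otimes>\<^sub>B A\<close>, and \<open>can\<close> is the induced map.
\<close>

definition can_lift :: "('a::complex_algebra \<Rightarrow> ('a, 'h::complex_algebra) tensor) \<Rightarrow> ('a, 'a) tensor \<Rightarrow> ('a, 'h) tensor" where
  "can_lift \<rho> = tensor_lift (\<lambda>a a'. tensor_lift (\<lambda>x h. (a * x) \<otimes>\<^sub>C h) (\<rho> a'))"

definition can :: "('a::complex_algebra \<Rightarrow> ('a, 'h::complex_algebra) tensor) \<Rightarrow> ('a, 'a) tensor set \<Rightarrow> ('a, 'h) tensor" where
  "can \<rho> C = the_elem (can_lift \<rho> ` C)"

definition right_hopf_galois :: "('a::complex_algebra \<Rightarrow> ('a, 'h::complex_algebra) tensor) \<Rightarrow> bool" where
  "right_hopf_galois \<rho> \<longleftrightarrow> bij_betw (can \<rho>) (balanced_tensor (coinvariants \<rho>)) UNIV"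

definition finite_dimensional :: "'a::complex_vector itself \<Rightarrow> bool" where
  "finite_dimensional _ \<longleftrightarrow> (\<exists>S :: 'a set. finite S \<and> cspan S = UNIV)"

end

theory Submission
  imports Defs "HOL-Computational_Algebra.Polynomial"
begin

text \<open>
  The obstruction is a matter of dimension. If \<open>A\<close> is finite dimensional then so is \<open>A \<otimes> A\<close>, and hence
  every quotient of it, in particular \<open>A \<otimes>\<^sub>B A\<close>. A surjective canonical map makes \<open>A \<otimes> H\<close> finite
  dimensional, and then \<open>H\<close> as well, because \<open>A \<noteq> 0\<close>; this is \<open>hopf_galois_imp_finite_dimensional\<close>, which
  holds for any \<open>H\<close>.

  But the Connes-Moscovici Hopf algebra is infinite dimensional, because the powers of a single generator
  \<open>\<delta>\<^sup>i\<^sub>i\<^sub>i\<close> are linearly independent. This operator multiplies \<open>g U\<^sub>\<phi>\<^sup>*\<close> by the function \<open>\<gamma>\<^sup>i\<^sub>i\<^sub>i(\<phi>)\<close>, so a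
  polynomial \<open>p\<close> in it multiplies by \<open>p(\<gamma>\<^sup>i\<^sub>i\<^sub>i(\<phi>))\<close>. If this operator is zero, then every value of
  \<open>\<gamma>\<^sup>i\<^sub>i\<^sub>i(\<phi>)\<close> at a point where some \<open>g\<close> does not vanish is a root of \<open>p\<close>. For the diffeomorphism that applies
  \<open>sinh\<close> to every coordinate, \<open>\<gamma>\<^sup>i\<^sub>i\<^sub>i(\<phi>)\<close> takes the value \<open>tanh x\<^sub>i\<close> at \<open>(x, 1)\<close> (\<open>frame_gamma_sinh\<close>), hence
  infinitely many values near \<open>x = 0\<close>, and a bump function (\<open>Cc_infty_bump\<close>) serves as \<open>g\<close>. So \<open>p = 0\<close>.
\<close>

section \<open>Tensor products of complex vector spaces\<close>

lemma cbilinear_pure_tensor: "cbilinear (\<otimes>\<^sub>C)"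
  unfolding cbilinear_def clinear_iff
  by (intro conjI allI; transfer; unfold tensor_eq_def;
    (subst diff_diff_eq[symmetric])?; rule complex_vector.span_base; unfold bilinear_relations_def; blast)

lemma pure_tensor_linear:
  "(v + v') \<otimes>\<^sub>C w = v \<otimes>\<^sub>C w + v' \<otimes>\<^sub>C w" "(c *\<^sub>C v) \<otimes>\<^sub>C w = c *\<^sub>C (v \<otimes>\<^sub>C w)"
  "v \<otimes>\<^sub>C (w + w') = v \<otimes>\<^sub>C w + v \<otimes>\<^sub>C w'" "v \<otimes>\<^sub>C (c *\<^sub>C w) = c *\<^sub>C (v \<otimes>\<^sub>C w)"
  using cbilinear_pure_tensor unfolding cbilinear_def clinear_iff by blast+

text \<open>
  The next three identities are read off from the sum that defines \<open>tensor_lift\<close>. They allow computations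
  with \<open>\<rho> a\<close> as if it were written out as a sum of pure tensors.
\<close>

lemma tensor_lift_compose:
  assumes "clinear f"
  shows "f (tensor_lift \<beta> t) = tensor_lift (\<lambda>v w. f (\<beta> v w)) t"
proof -
  interpret Vector_Spaces.linear scaleC scaleC f by (rule assms)
  show ?thesis by (simp add: tensor_lift_def sum scale case_prod_beta')
qed

lemma tensor_lift_add:
  "tensor_lift (\<lambda>v w. \<beta> v w + \<beta>' v w) t = tensor_lift \<beta> t + tensor_lift \<beta>' t"
  by (simp add: tensor_lift_def case_prod_beta' scaleC_add_right sum.distrib)

lemma tensor_lift_scaleC: "tensor_lift (\<lambda>v w. c *\<^sub>C \<beta> v w) t = c *\<^sub>C tensor_lift \<beta> t"
  by (simp add: tensor_lift_def case_prod_beta' complex_vector.scale_sum_right scaleC_scaleC mult.commute)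

lemma tensor_lift_in_span:
  assumes "cbilinear \<beta>" "cspan S = UNIV" "cspan T = UNIV"
  shows "tensor_lift \<beta> t \<in> cspan ((\<lambda>(v, w). \<beta> v w) ` (S \<times> T))" (is "_ \<in> cspan ?R")
proof -
  have left: "\<beta> v w \<in> cspan ?R" if "w \<in> T" for v w
  proof -
    interpret Vector_Spaces.linear scaleC scaleC "\<lambda>v. \<beta> v w"
      using assms(1) unfolding cbilinear_def by blast
    have "\<beta> v w \<in> (\<lambda>v. \<beta> v w) ` cspan S" using assms(2) by blast
    also have "\<dots> = cspan ((\<lambda>v. \<beta> v w) ` S)" by (rule span_image[symmetric])
    also have "\<dots> \<subseteq> cspan ?R" using that by (intro complex_vector.span_mono) auto
    finally show ?thesis .
  qed
  have "\<beta> v w \<in> cspan ?R" for v w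
  proof -
    interpret Vector_Spaces.linear scaleC scaleC "\<beta> v"
      using assms(1) unfolding cbilinear_def by blast
    have "\<beta> v w \<in> \<beta> v ` cspan T" using assms(3) by blast
    also have "\<dots> = cspan (\<beta> v ` T)" by (rule span_image[symmetric])
    also have "\<dots> \<subseteq> cspan ?R"
      using left by (intro complex_vector.span_minimal complex_vector.subspace_span) auto
    finally show ?thesis .
  qed
  then show ?thesis
    unfolding tensor_lift_def case_prod_beta'
    by (intro complex_vector.span_sum complex_vector.span_scale)
qed

text \<open>
  A functional \<open>l\<close> with \<open>l a = 1\<close> turns \<open>x \<otimes> h \<mapsto> l(x) h\<close> into a linear map that hits every \<open>h\<close>, as the
  image of \<open>a \<otimes> h\<close>. So the second factor inherits a finite spanning set.
\<close>

lemma right_factor_finite_dimensional: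
  fixes a :: "'a::complex_vector" and F :: "('a, 'h::complex_vector) tensor set"
  assumes "a \<noteq> 0" "finite F" "cspan F = UNIV"
  shows "finite_dimensional TYPE('h)"
proof -
  interpret p: vector_space_pair "scaleC :: complex \<Rightarrow> 'a \<Rightarrow> 'a" "scaleC :: complex \<Rightarrow> complex \<Rightarrow> complex" ..
  obtain l :: "'a \<Rightarrow> complex" where l: "clinear l" "l a = 1"
    using p.linear_independent_extend[of "{a}" "\<lambda>_. 1"] assms(1) by auto
  let ?\<beta> = "\<lambda>x (h::'h). l x *\<^sub>C h"
  have bil: "cbilinear ?\<beta>"
    using l(1) by (simp add: cbilinear_def clinear_iff scaleC_add_left scaleC_add_right scaleC_scaleC
      scaleC_complex_def mult.commute)
  interpret q: Vector_Spaces.linear scaleC scaleC "tensor_lift ?\<beta>" by (rule clinear_tensor_lift[OF bil])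
  have "h \<in> tensor_lift ?\<beta> ` cspan F" for h
  proof -
    have "h = tensor_lift ?\<beta> (a \<otimes>\<^sub>C h)" by (simp add: tensor_lift_pure[OF bil] l(2) scaleC_one)
    then show ?thesis unfolding assms(3) by (rule range_eqI)
  qed
  then have "cspan (tensor_lift ?\<beta> ` F) = UNIV" by (auto simp: q.span_image)
  then show ?thesis using assms(2) unfolding finite_dimensional_def by blast
qed

section \<open>The image of the canonical map\<close>

lemma cbilinear_left_mult_pure:
  fixes a :: "'a::complex_algebra"
  shows "cbilinear (\<lambda>x (h::'h::complex_vector). (a * x) \<otimes>\<^sub>C h)"
  by (simp add: cbilinear_def clinear_iff pure_tensor_linear distrib_left mult_scaleC_right)

lemma cbilinear_can:
  fixes \<rho> :: "'a::complex_algebra \<Rightarrow> ('a, 'h::complex_vector) tensor"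
  assumes "clinear \<rho>"
  shows "cbilinear (\<lambda>a a'. tensor_lift (\<lambda>x h. (a * x) \<otimes>\<^sub>C h) (\<rho> a'))"
  unfolding cbilinear_def
proof (intro conjI allI)
  fix a
  show "clinear (\<lambda>a'. tensor_lift (\<lambda>x h. (a * x) \<otimes>\<^sub>C h) (\<rho> a'))"
    using assms clinear_tensor_lift[OF cbilinear_left_mult_pure[where 'h='h and a = a]] by (simp add: clinear_iff)
next
  fix a'
  have "(\<otimes>\<^sub>C) (v + v') = (\<lambda>h :: 'h. v \<otimes>\<^sub>C h + v' \<otimes>\<^sub>C h)" "(\<otimes>\<^sub>C) (c *\<^sub>C v) = (\<lambda>h :: 'h. c *\<^sub>C (v \<otimes>\<^sub>C h))"
    for v v' :: 'a and c by (simp_all add: fun_eq_iff pure_tensor_linear)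
  then show "clinear (\<lambda>a. tensor_lift (\<lambda>x h. (a * x) \<otimes>\<^sub>C h) (\<rho> a'))"
    by (simp add: clinear_iff distrib_right mult_scaleC_left tensor_lift_add tensor_lift_scaleC)
qed

lemma tensor_mult_pure_one:
  "tensor_mult (b \<otimes>\<^sub>C 1) t = tensor_lift (\<lambda>x h. (b * x) \<otimes>\<^sub>C h) t"
proof -
  have "cbilinear (\<lambda>a b. tensor_lift (\<lambda>a' b'. (a * a') \<otimes>\<^sub>C (b * b')) t)"
    by (simp add: cbilinear_def clinear_iff pure_tensor_linear distrib_right mult_scaleC_left
      tensor_lift_add tensor_lift_scaleC)
  then show ?thesis by (simp add: tensor_mult_def tensor_lift_pure)
qed

text \<open>
  This is the reason why \<open>can\<close> is defined on \<open>A \<otimes>\<^sub>B A\<close>: as \<open>\<rho>\<close> is multiplicative and \<open>\<rho> b = b \<otimes> 1\<close>, we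
  have \<open>\<rho>(b a') = b a'\<^sub>0 \<otimes> a'\<^sub>1\<close>, so both sides equal \<open>a b a'\<^sub>0 \<otimes> a'\<^sub>1\<close>.
\<close>

lemma can_lift_balanced:
  assumes \<rho>: "right_comodule_algebra \<Delta> \<epsilon> \<rho>" and b: "b \<in> coinvariants \<rho>"
  shows "can_lift \<rho> ((a * b) \<otimes>\<^sub>C a') = can_lift \<rho> (a \<otimes>\<^sub>C (b * a'))"
proof -
  have lin: "clinear \<rho>" and mult: "\<rho> (b * a') = tensor_mult (\<rho> b) (\<rho> a')"
    using \<rho> by (auto simp: right_comodule_algebra_def)
  have "can_lift \<rho> (a \<otimes>\<^sub>C (b * a'))
      = tensor_lift (\<lambda>x h. (a * x) \<otimes>\<^sub>C h) (tensor_lift (\<lambda>x h. (b * x) \<otimes>\<^sub>C h) (\<rho> a'))"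
    using b by (simp add: can_lift_def tensor_lift_pure[OF cbilinear_can[OF lin]] mult
      coinvariants_def tensor_mult_pure_one)
  also have "\<dots> = tensor_lift (\<lambda>x h. (a * b * x) \<otimes>\<^sub>C h) (\<rho> a')"
    unfolding tensor_lift_compose[OF clinear_tensor_lift[OF cbilinear_left_mult_pure]]
    by (simp add: tensor_lift_pure[OF cbilinear_left_mult_pure] mult.assoc)
  also have "\<dots> = can_lift \<rho> ((a * b) \<otimes>\<^sub>C a')"
    by (simp add: can_lift_def tensor_lift_pure[OF cbilinear_can[OF lin]])
  finally show ?thesis by simp
qed

text \<open>
  \<open>can\<close> picks the only element of the image of a coset under \<open>can_lift \<rho>\<close>, which says something about
  \<open>can\<close> only once that image is known to be a singleton.
\<close>

lemma can_in_range_can_lift: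
  assumes \<rho>: "right_comodule_algebra \<Delta> \<epsilon> \<rho>" and C: "C \<in> balanced_tensor (coinvariants \<rho>)"
  shows "can \<rho> C \<in> range (can_lift \<rho>)"
proof -
  let ?R = "balanced_relations (coinvariants \<rho>)"
  have lin: "clinear \<rho>" using \<rho> by (simp add: right_comodule_algebra_def)
  interpret Vector_Spaces.linear scaleC scaleC "can_lift \<rho>"
    unfolding can_lift_def by (rule clinear_tensor_lift[OF cbilinear_can[OF lin]])
  obtain s where C_eq: "C = {t. s - t \<in> cspan ?R}"
    using C by (auto simp: balanced_tensor_def quotient_def)
  have "can_lift \<rho> r = 0" if "r \<in> cspan ?R" for r
    using that
  proof (rule eq_0_on_span[rotated])
    fix x assume "x \<in> ?R"
    then show "can_lift \<rho> x = 0"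
      using can_lift_balanced[OF \<rho>] by (auto simp: balanced_relations_def diff)
  qed
  then have "can_lift \<rho> (s - t) = 0" if "t \<in> C" for t using that by (simp add: C_eq)
  then have "can_lift \<rho> t = can_lift \<rho> s" if "t \<in> C" for t using that by (simp add: diff)
  moreover have "s \<in> C" by (simp add: C_eq complex_vector.span_zero)
  ultimately have "can_lift \<rho> ` C = {can_lift \<rho> s}" by blast
  then show ?thesis by (simp add: can_def)
qed

text \<open>
  Surjectivity of \<open>can\<close> makes \<open>A \<otimes> H\<close> a linear image of the finite dimensional space \<open>A \<otimes> A\<close>. The class
  \<open>ring_1\<close> supplies \<open>1 \<noteq> 0\<close> in \<open>A\<close>; over the zero algebra both sides of \<open>can\<close> vanish, whatever \<open>H\<close> is.
\<close>

lemma hopf_galois_imp_finite_dimensional: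
  fixes \<rho> :: "'a::{complex_algebra, ring_1} \<Rightarrow> ('a, 'h::complex_algebra) tensor"
  assumes fin: "finite_dimensional TYPE('a)" and \<rho>: "right_comodule_algebra \<Delta> \<epsilon> \<rho>"
    and galois: "right_hopf_galois \<rho>"
  shows "finite_dimensional TYPE('h)"
proof -
  let ?\<beta> = "\<lambda>a a'. tensor_lift (\<lambda>x h. (a * x) \<otimes>\<^sub>C h) (\<rho> a')"
  have bil: "cbilinear ?\<beta>" using \<rho> by (simp add: right_comodule_algebra_def cbilinear_can)
  obtain S :: "'a set" where S: "finite S" "cspan S = UNIV"
    using fin by (auto simp: finite_dimensional_def)
  let ?F = "(\<lambda>(a, a'). ?\<beta> a a') ` (S \<times> S)"
  have "t \<in> cspan ?F" for t
  proof -
    obtain C where "C \<in> balanced_tensor (coinvariants \<rho>)" "t = can \<rho> C"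
      using galois unfolding right_hopf_galois_def bij_betw_def by blast
    then obtain s where "t = can_lift \<rho> s" using can_in_range_can_lift[OF \<rho>] by blast
    then show ?thesis using tensor_lift_in_span[OF bil S(2) S(2)] by (simp add: can_lift_def)
  qed
  then show ?thesis
    using S(1) by (intro right_factor_finite_dimensional[of "1::'a" ?F]) auto
qed

section \<open>Elements that satisfy no polynomial equation\<close>

text \<open>
  A functional \<open>E\<close> with \<open>E(h\<^sup>m) = c\<^sup>m E(1)\<close> maps \<open>p(h)\<close> to \<open>p(c) E(1)\<close> for every polynomial \<open>p\<close>, as
  evaluation at an eigenvector does. So \<open>p(h) = 0\<close> forces every such \<open>c\<close> to be a root of \<open>p\<close>, and with
  infinitely many \<open>c\<close> the powers of \<open>h\<close> are linearly independent.
\<close>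

lemma infinite_spectrum_imp_infinite_dimensional:
  fixes h :: "'h::complex_algebra"
  assumes inf: "infinite {c :: complex. \<exists>E. clinear E \<and> E 1 \<noteq> 0 \<and> (\<forall>m. E (h ^ m) = c ^ m * E 1)}" (is "infinite ?C")
  shows "\<not> finite_dimensional TYPE('h)"
proof
  have coeff_zero: "u m = 0" if M: "finite M" "m \<in> M" and rel: "(\<Sum>m\<in>M. u m *\<^sub>C h ^ m) = 0" for M u m
  proof -
    let ?p = "\<Sum>m\<in>M. monom (u m) m"
    have "poly ?p c = 0" if c: "c \<in> ?C" for c
    proof -
      from c obtain E where E: "clinear E" "E 1 \<noteq> 0" "\<And>m. E (h ^ m) = c ^ m * E 1" by blast
      interpret Vector_Spaces.linear scaleC scaleC E by (rule E(1))
      have "0 = E (\<Sum>m\<in>M. u m *\<^sub>C h ^ m)" by (simp add: rel zero)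
      also have "\<dots> = poly ?p c * E 1"
        unfolding sum by (simp add: scale E(3) scaleC_complex_def poly_sum poly_monom sum_distrib_right mult.assoc)
      finally show ?thesis using E(2) by simp
    qed
    then have sub: "?C \<subseteq> {c. poly ?p c = 0}" by blast
    have "?p = 0"
    proof (rule ccontr)
      assume "?p \<noteq> 0"
      then show False using finite_subset[OF sub poly_roots_finite] inf by blast
    qed
    then have "0 = coeff ?p m" by simp
    also have "\<dots> = u m" using M by (simp add: coeff_sum)
    finally show ?thesis by simp
  qed
  have inj: "inj ((^) h)"
  proof (rule injI, rule ccontr)
    fix i j assume "h ^ i = h ^ j" "i \<noteq> j"
    then show False
      using coeff_zero[of "{i, j}" i "\<lambda>m. if m = i then 1 else -1"] by (simp add: scaleC_one)
  qed
  assume "finite_dimensional TYPE('h)"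
  then obtain S :: "'h set" where S: "finite S" "cspan S = UNIV" by (auto simp: finite_dimensional_def)
  \<comment> \<open>one power more than the spanning set has elements\<close>
  let ?P = "(^) h ` {..card S}"
  have "complex_vector.independent ?P"
  proof (rule complex_vector.independent_if_scalars_zero)
    fix f x assume "(\<Sum>x\<in>?P. f x *\<^sub>C x) = 0" "x \<in> ?P"
    moreover have "(\<Sum>x\<in>?P. f x *\<^sub>C x) = (\<Sum>m\<in>{..card S}. f (h ^ m) *\<^sub>C h ^ m)"
      using inj by (subst sum.reindex) (auto intro: inj_on_subset)
    ultimately show "f x = 0" using coeff_zero[of "{..card S}" _ "\<lambda>m. f (h ^ m)"] by auto
  qed simp
  then have "card ?P \<le> card S"
    using complex_vector.independent_span_bound[OF S(1)] S(2) by simp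
  moreover have "card ?P = Suc (card S)"
    using inj by (subst card_image) (auto intro: inj_on_subset)
  ultimately show False by simp
qed

section \<open>Smooth functions of one real variable\<close>

text \<open>
  With this criterion smoothness needs no formula for the higher derivatives, only a family of functions
  that contains a derivative of each of its members.
\<close>

lemma smooth_on_if_derivative_closed:
  fixes \<F> :: "(real \<Rightarrow> real) set"
  assumes "\<And>f. f \<in> \<F> \<Longrightarrow> \<exists>f'\<in>\<F>. \<forall>t. (f has_real_derivative f' t) (at t)" and "f \<in> \<F>"
  shows "smooth_on UNIV f"
proof -
  have "Ck_on k UNIV f" if "f \<in> \<F>" for k f
    using that
  proof (induction k arbitrary: f)
    case 0
    then show ?case using assms(1) by (fastforce intro!: continuous_at_imp_continuous_on DERIV_isCont)
  next
    case (Suc k)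
    then obtain f' where f': "f' \<in> \<F>" "\<And>t. (f has_real_derivative f' t) (at t)" using assms(1) by blast
    show ?case
      by (intro Ck_on_SucI[where f' = "\<lambda>t v. f' t * v"] Ck_on_bilinear[OF _ bounded_bilinear_mult]
          Ck_on_const Suc.IH f' has_field_derivative_imp_has_derivative open_UNIV)
  qed
  then show ?thesis using assms(2) by (simp add: smooth_on_def)
qed

text \<open>
  The classical function \<open>exp(-1/t)\<close>, extended by 0 to \<open>t \<le> 0\<close>, is the case \<open>P = 1\<close>. The factor \<open>P(1/t)\<close>
  closes the family under derivatives.
\<close>

definition flat_exp :: "real poly \<Rightarrow> real \<Rightarrow> real" where
  "flat_exp P t = (if t > 0 then poly P (1 / t) * exp (- 1 / t) else 0)"

lemma flat_exp_tendsto_0: "(flat_exp P \<longlongrightarrow> 0) (at_right 0)"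
proof -
  have "((\<lambda>s. \<Sum>i\<le>degree P. coeff P i * (s ^ i / exp s)) \<longlongrightarrow> (\<Sum>i\<le>degree P. coeff P i * 0)) at_top"
    by (intro tendsto_sum tendsto_mult tendsto_const tendsto_power_div_exp_0)
  then have "((\<lambda>s. poly P s * exp (- s)) \<longlongrightarrow> 0) at_top"
    by (simp add: poly_altdef sum_distrib_right exp_minus divide_inverse mult.assoc)
  then have "((\<lambda>t. poly P (inverse t) * exp (- inverse t)) \<longlongrightarrow> 0) (at_right 0)"
    by (rule filterlim_compose) (rule filterlim_inverse_at_top_right)
  then show ?thesis
    by (rule Lim_transform_eventually)
      (auto simp: flat_exp_def eventually_at_filter divide_inverse)
qed

lemma flat_exp_has_derivative:
  "(flat_exp P has_real_derivative flat_exp ([:0, 0, 1:] * (P - pderiv P)) t) (at t)"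
proof -
  consider "t > 0" | "t < 0" | "t = 0" by linarith
  then show ?thesis
  proof cases
    case 1
    have "((\<lambda>t. poly P (1 / t) * exp (- 1 / t)) has_real_derivative
        flat_exp ([:0, 0, 1:] * (P - pderiv P)) t) (at t)"
      using 1 by (auto intro!: derivative_eq_intros poly_DERIV[THEN DERIV_chain2]
        simp: flat_exp_def field_simps power2_eq_square)
    then show ?thesis
      by (rule has_field_derivative_transform_within_open[where S = "{0<..}"]) (use 1 in \<open>auto simp: flat_exp_def\<close>)
  next
    case 2
    have "((\<lambda>t. 0) has_real_derivative flat_exp ([:0, 0, 1:] * (P - pderiv P)) t) (at t)"
      using 2 by (simp add: flat_exp_def)
    then show ?thesis
      by (rule has_field_derivative_transform_within_open[where S = "{..<0}"]) (use 2 in \<open>auto simp: flat_exp_def\<close>)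
  next
    case 3
    \<comment> \<open>the difference quotient at 0 belongs to the family again, for the polynomial \<open>s P(s)\<close>\<close>
    have "((\<lambda>t. flat_exp P t / t) \<longlongrightarrow> 0) (at_right 0)"
      using flat_exp_tendsto_0[of "[:0, 1:] * P"]
      by (rule Lim_transform_eventually) (auto simp: flat_exp_def eventually_at_filter)
    moreover have "((\<lambda>t. flat_exp P t / t) \<longlongrightarrow> 0) (at_left 0)"
      by (rule Lim_transform_eventually[OF tendsto_const]) (auto simp: flat_exp_def eventually_at_filter)
    ultimately show ?thesis
      using 3 by (simp add: has_field_derivative_iff flat_exp_def filterlim_split_at)
  qed
qed

lemma smooth_flat_exp: "smooth_on UNIV (flat_exp P)"
  by (rule smooth_on_if_derivative_closed[of "range flat_exp"]) (use flat_exp_has_derivative in blast)+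

lemma smooth_cosh: "smooth_on UNIV (cosh :: real \<Rightarrow> real)"
  and smooth_sinh: "smooth_on UNIV (sinh :: real \<Rightarrow> real)"
  by (rule smooth_on_if_derivative_closed[of "{sinh, cosh}"]; auto intro!: derivative_eq_intros)+

text \<open>
  Bootstrapping: the derivative \<open>1 / cosh(arsinh t)\<close> is as smooth as \<open>arsinh\<close> itself, so each order of
  differentiability yields the next.
\<close>

lemma smooth_arsinh: "smooth_on UNIV (arsinh :: real \<Rightarrow> real)"
proof -
  have der: "(arsinh has_real_derivative inverse (cosh (arsinh t))) (at t)" for t :: real
    by (auto intro!: derivative_eq_intros simp: cosh_arsinh_real divide_inverse)
  have "Ck_on k UNIV (arsinh :: real \<Rightarrow> real)" for k
  proof (induction k)
    case 0
    then show ?case using der by (auto intro!: continuous_at_imp_continuous_on DERIV_isCont)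
  next
    case (Suc k)
    have "Ck_on k UNIV (\<lambda>t. inverse (cosh (arsinh t :: real)))"
      using smooth_cosh Ck_on_compose[OF open_UNIV open_UNIV _ _ Suc]
      by (intro Ck_on_inverse) (auto simp: smooth_on_def)
    then show ?case
      by (intro Ck_on_SucI[where f' = "\<lambda>t v. inverse (cosh (arsinh t)) * v"])
        (auto intro!: Ck_on_bilinear[OF _ bounded_bilinear_mult] Ck_on_const has_field_derivative_imp_has_derivative der)
  qed
  then show ?thesis by (simp add: smooth_on_def)
qed

section \<open>A nonzero function of compact support on the frame bundle\<close>

lemma Cc_infty_bump:
  assumes "p \<in> frame_bundle"
  obtains g r where "g \<in> Cc_infty" "r > 0" "\<And>q. q \<in> ball p r \<Longrightarrow> g q \<noteq> 0"
proof -
  obtain r where r: "r > 0" "cball p r \<subseteq> frame_bundle"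
    using open_contains_cball[of frame_bundle] open_frame_bundle assms by blast
  let ?g = "\<lambda>q. complex_of_real (flat_exp 1 (r\<^sup>2 - (q - p) \<bullet> (q - p)))"
  have nz: "?g q \<noteq> 0 \<longleftrightarrow> q \<in> ball p r" for q
  proof -
    have "?g q \<noteq> 0 \<longleftrightarrow> (norm (q - p))\<^sup>2 < r\<^sup>2" by (simp add: flat_exp_def power2_norm_eq_inner)
    also have "\<dots> \<longleftrightarrow> q \<in> ball p r"
      using r(1) power_mono_iff[of r "norm (q - p)" 2] by (simp add: dist_norm norm_minus_commute not_le[symmetric])
    finally show ?thesis .
  qed
  note S = open_frame_bundle
  have q: "smooth_on frame_bundle (\<lambda>q. q - p)"
    using smooth_on_add[OF S smooth_on_linear[OF S bounded_linear_ident] smooth_on_const[OF S, of "- p"]] by simp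
  have "smooth_on frame_bundle (\<lambda>q. r\<^sup>2 + (-1) * ((q - p) \<bullet> (q - p)))"
    by (intro smooth_on_add[OF S] smooth_on_mult[OF S] smooth_on_const[OF S]
      smooth_on_bilinear[OF S bounded_bilinear_inner] q)
  then have "smooth_on frame_bundle ?g"
    using smooth_on_compose[OF S open_UNIV _ smooth_flat_exp] by (intro smooth_of_real[OF S]) simp
  moreover have "?g q = 0" if "q \<notin> cball p r" for q
    using nz[of q] that by auto
  ultimately have "?g \<in> Cc_infty"
    unfolding Cc_infty_def using r(2) by (intro CollectI conjI exI[of _ "cball p r"]) auto
  from this r(1) show thesis by (rule that) (simp only: nz)
qed

section \<open>A diffeomorphism with nonconstant gamma\<close>

text \<open>
  Any diffeomorphism for which \<open>\<gamma>\<^sup>i\<^sub>i\<^sub>i\<close> takes infinitely many values near one point would do. Acting on each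
  coordinate separately keeps the Jacobian diagonal, and \<open>sinh\<close> is a bijection of the line with an explicit
  smooth inverse.
\<close>

lift_definition sinh_diffeo :: "('n::finite) diffeo" is "\<lambda>x. \<chi> i. sinh (x $ i)"
proof -
  have "inv (\<lambda>x. \<chi> i. sinh (x $ i)) = (\<lambda>x :: real ^ 'n. \<chi> i. arsinh (x $ i))"
    by (rule inv_equality) (simp_all add: vec_eq_iff arsinh_sinh_real)
  moreover have "bij (\<lambda>x :: real ^ 'n. \<chi> i. sinh (x $ i))"
    by (rule bij_betw_byWitness[where f' = "\<lambda>x. \<chi> i. arsinh (x $ i)"]) (auto simp: vec_eq_iff arsinh_sinh_real)
  moreover have "smooth_on UNIV (\<lambda>x :: real ^ 'n. \<chi> i. f (x $ i))" if "smooth_on UNIV f" for f :: "real \<Rightarrow> real"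
    using smooth_on_compose[OF open_UNIV open_UNIV _ that smooth_on_linear[OF open_UNIV bounded_linear_vec_nth]]
    by (intro smooth_on_vec) auto
  ultimately show "bij (\<lambda>x :: real ^ 'n. \<chi> i. sinh (x $ i)) \<and> smooth_on UNIV (\<lambda>x :: real ^ 'n. \<chi> i. sinh (x $ i)) \<and>
      smooth_on UNIV (inv (\<lambda>x :: real ^ 'n. \<chi> i. sinh (x $ i)))"
    using smooth_sinh smooth_arsinh by simp
qed

lemma vec_nth_compose_has_derivative:
  fixes f :: "real \<Rightarrow> real"
  assumes "(f has_real_derivative f') (at (x $ i))"
  shows "((\<lambda>x. f (x $ i)) has_derivative (\<lambda>v. f' * v $ i)) (at x)"
  using has_derivative_compose[OF bounded_linear_imp_has_derivative[OF bounded_linear_vec_nth]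
      has_field_derivative_imp_has_derivative[OF assms]] .

lemma sinh_diffeo_jacobian:
  "diffeo_jacobian sinh_diffeo x = (\<chi> i j. if i = j then cosh (x $ i) else 0)"
proof -
  have "diffeo_jacobian sinh_diffeo x $ i $ j = (if i = j then cosh (x $ i) else 0)" for i j
  proof -
    have "((\<lambda>x. Rep_diffeo sinh_diffeo x $ i) has_derivative (\<lambda>v. (diffeo_jacobian sinh_diffeo x *v v) $ i)) (at x)"
      by (rule bounded_linear.has_derivative[OF bounded_linear_vec_nth diffeo_has_derivative])
    moreover have "((\<lambda>x. Rep_diffeo sinh_diffeo x $ i) has_derivative (\<lambda>v. cosh (x $ i) * v $ i)) (at x)"
      unfolding sinh_diffeo.rep_eq vec_lambda_beta
      by (rule vec_nth_compose_has_derivative) (auto intro!: derivative_eq_intros)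
    ultimately have "(\<lambda>v. (diffeo_jacobian sinh_diffeo x *v v) $ i) = (\<lambda>v. cosh (x $ i) * v $ i)"
      by (rule has_derivative_unique)
    then have "(diffeo_jacobian sinh_diffeo x *v axis j 1) $ i = cosh (x $ i) * axis j 1 $ i" by metis
    then show ?thesis
      by (simp add: matrix_vector_mul_component inner_axis) (simp add: axis_def)
  qed
  then show ?thesis by (simp add: vec_eq_iff)
qed

lemma matrix_inv_diagonal:
  assumes "\<And>i. d i \<noteq> (0::real)"
  shows "matrix_inv (\<chi> i j. if i = j then d i else 0) = (\<chi> i j. if i = j then inverse (d i) else 0)"
    (is "matrix_inv ?A = ?B")
proof -
  have "?A ** ?B = mat 1" and BA: "?B ** ?A = mat 1"
    using assms by (simp_all add: matrix_matrix_mult_def mat_def vec_eq_iff if_distrib[of "\<lambda>c. c * _"] cong: if_cong)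
  then have "\<exists>B. ?A ** B = mat 1 \<and> B ** ?A = mat 1" by (intro exI conjI)
  then have "?A ** matrix_inv ?A = mat 1 \<and> matrix_inv ?A ** ?A = mat 1"
    unfolding matrix_inv_def by (rule someI_ex)
  then have "?B ** (?A ** matrix_inv ?A) = ?B" by (simp only: matrix_mul_rid)
  then show ?thesis by (simp only: matrix_mul_assoc BA matrix_mul_lid)
qed

text \<open>
  At the standard frame \<open>\<gamma>\<^sup>i\<^sub>i\<^sub>i\<close> is the \<open>i\<close>-th diagonal entry of \<open>\<phi>'(x)\<^sup>-\<^sup>1 \<partial>\<^sub>i\<phi>'(x)\<close>. As \<open>\<phi>'(x)\<close> is
  diagonal with entries \<open>cosh x\<^sub>i\<close>, this is \<open>sinh x\<^sub>i / cosh x\<^sub>i\<close>.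
\<close>

lemma frame_gamma_sinh:
  "frame_gamma sinh_diffeo i i i (x, mat 1) = tanh (x $ i)"
proof -
  let ?D = "diffeo_jacobian sinh_diffeo"
  have D: "(?D has_derivative frechet_derivative ?D (at x)) (at x)"
    using smooth_on_has_derivative[OF smooth_diffeo_jacobian] by blast
  have "((\<lambda>x. ?D x $ i $ i) has_derivative (\<lambda>v. frechet_derivative ?D (at x) v $ i $ i)) (at x)"
    by (intro bounded_linear.has_derivative[OF bounded_linear_vec_nth] D)
  moreover have "((\<lambda>x. ?D x $ i $ i) has_derivative (\<lambda>v. sinh (x $ i) * v $ i)) (at x)"
    unfolding sinh_diffeo_jacobian
    by (simp, rule vec_nth_compose_has_derivative) (auto intro!: derivative_eq_intros)
  ultimately have "(\<lambda>v. frechet_derivative ?D (at x) v $ i $ i) = (\<lambda>v. sinh (x $ i) * v $ i)"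
    by (rule has_derivative_unique)
  then have D': "frechet_derivative ?D (at x) (axis i 1) $ i $ i = sinh (x $ i)" by (simp add: fun_eq_iff)
  have inv: "matrix_inv (?D x) = (\<chi> i j. if i = j then inverse (cosh (x $ i)) else 0)"
    unfolding sinh_diffeo_jacobian by (rule matrix_inv_diagonal) simp
  have one: "matrix_inv (mat 1 :: real ^ 'a ^ 'a) = mat 1"
    using matrix_inv_diagonal[of "\<lambda>_::'a. 1"] by (simp add: mat_def cong: if_cong)
  have "frame_gamma sinh_diffeo i i i (x, mat 1) =
      (\<Sum>\<mu>\<in>UNIV. (matrix_inv (?D x) ** frechet_derivative ?D (at x) (axis \<mu> 1)) $ i $ i * mat 1 $ \<mu> $ i)"
    by (simp add: frame_gamma_def one)
  also have "\<dots> = (matrix_inv (?D x) ** frechet_derivative ?D (at x) (axis i 1)) $ i $ i"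
    by (simp add: mat_def if_distrib[of "\<lambda>c. _ * c"] cong: if_cong)
  also have "\<dots> = inverse (cosh (x $ i)) * sinh (x $ i)"
    by (simp add: inv matrix_matrix_mult_def if_distrib[of "\<lambda>c. c * _"] D' cong: if_cong)
  finally show ?thesis by (simp add: tanh_def divide_inverse)
qed

section \<open>The Connes-Moscovici Hopf algebra is infinite dimensional\<close>

lift_definition cm_delta :: "'n \<Rightarrow> 'n \<Rightarrow> 'n \<Rightarrow> ('n::finite) connes_moscovici" is op_delta
  by (rule connes_moscovici_ops.intros)

lemma cm_delta_power_apply:
  "Rep_ccfun (Poly_Mapping.lookup (cm_apply (cm_delta i j k ^ m) a) \<phi>) p =
     complex_of_real (frame_gamma \<phi> i j k p) ^ m * Rep_ccfun (Poly_Mapping.lookup a \<phi>) p"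
proof (induction m)
  case 0
  then show ?case by (simp add: cm_apply_def one_connes_moscovici.rep_eq)
next
  case (Suc m)
  have "ccfun_gamma \<phi> i j k 0 = 0" by transfer simp
  then have lookup: "Poly_Mapping.lookup (op_delta i j k b) \<phi> = ccfun_gamma \<phi> i j k (Poly_Mapping.lookup b \<phi>)" for b
    by (simp add: op_delta_def lookup_mapp when_def in_keys_iff)
  show ?case
    using Suc by (simp add: cm_apply_def times_connes_moscovici.rep_eq cm_delta.rep_eq lookup ccfun_gamma.rep_eq)
qed

text \<open>
  The functionals \<open>?E s\<close> evaluate an operator at \<open>g U\<^sub>\<phi>\<^sup>*\<close> and the point \<open>(s, ..., s; 1)\<close>, where \<open>\<phi>\<close> is
  \<open>sinh_diffeo\<close> and \<open>g\<close> a bump function around \<open>(0; 1)\<close>. Under them \<open>\<delta>\<^sup>i\<^sub>i\<^sub>i\<close> has the eigenvalue \<open>tanh s\<close>, for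
  all \<open>s\<close> in a neighbourhood of 0 on which \<open>g\<close> does not vanish.
\<close>

lemma connes_moscovici_infinite_dimensional:
  "\<not> finite_dimensional TYPE(('n::finite) connes_moscovici)"
proof -
  let ?p = "\<lambda>s. (vec s, mat 1) :: 'n frame"
  \<comment> \<open>\<open>\<delta>\<^sup>i\<^sub>i\<^sub>i\<close> for an arbitrary index \<open>i\<close>\<close>
  let ?h = "cm_delta undefined undefined undefined :: 'n connes_moscovici"
  have "?p 0 \<in> frame_bundle" by (auto simp: frame_bundle_def invertible_def intro: exI[of _ "mat 1"])
  then obtain g r where g: "g \<in> Cc_infty" "r > 0" "\<And>q. q \<in> ball (?p 0) r \<Longrightarrow> g q \<noteq> 0"
    using Cc_infty_bump by blast
  let ?I = "?p -` ball (?p 0) r"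
  let ?E = "\<lambda>s h. Rep_ccfun (Poly_Mapping.lookup (cm_apply h (Poly_Mapping.single sinh_diffeo (Abs_ccfun g))) sinh_diffeo) (?p s)"
  have E: "\<exists>E. clinear E \<and> E 1 \<noteq> 0 \<and> (\<forall>m. E (?h ^ m) = complex_of_real (tanh s) ^ m * E 1)" if s: "s \<in> ?I" for s
  proof (intro exI conjI allI)
    show "clinear (?E s)"
      by (simp add: clinear_iff cm_apply_def plus_connes_moscovici.rep_eq scaleC_connes_moscovici.rep_eq
        lookup_add lookup_scaleC plus_ccfun.rep_eq scaleC_ccfun.rep_eq scaleC_complex_def)
    show "?E s (?h ^ m) = complex_of_real (tanh s) ^ m * ?E s 1" for m
      by (simp add: cm_delta_power_apply frame_gamma_sinh) (simp add: cm_apply_def one_connes_moscovici.rep_eq)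
    show "?E s 1 \<noteq> 0"
      using g(3) s by (simp add: cm_apply_def one_connes_moscovici.rep_eq Abs_ccfun_inverse[OF g(1)])
  qed
  have "continuous_on UNIV ?p"
    by (intro continuous_intros) (simp add: vec_def continuous_on_vec_lambda)
  then have "open ?I" by (intro open_vimage) auto
  moreover have "0 \<in> ?I" using g(2) by simp
  ultimately have "infinite ?I" using finite_imp_not_open by blast
  moreover have "inj_on (\<lambda>s. complex_of_real (tanh s)) ?I" by (simp add: inj_on_def)
  ultimately have "infinite ((\<lambda>s. complex_of_real (tanh s)) ` ?I)" by (simp add: finite_image_iff)
  moreover have "(\<lambda>s. complex_of_real (tanh s)) ` ?I
      \<subseteq> {c. \<exists>E. clinear E \<and> E 1 \<noteq> 0 \<and> (\<forall>m. E (?h ^ m) = c ^ m * E 1)}"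
    using E by (intro image_subsetI CollectI)
  ultimately have "infinite {c :: complex. \<exists>E. clinear E \<and> E 1 \<noteq> 0 \<and> (\<forall>m. E (?h ^ m) = c ^ m * E 1)}"
    by (rule infinite_super[rotated])
  then show ?thesis by (rule infinite_spectrum_imp_infinite_dimensional)
qed

theorem proposition4p3:
  fixes \<rho> :: "'a::{complex_algebra, ring_1} \<Rightarrow> ('a, ('n::finite) connes_moscovici) tensor"
  assumes "finite_dimensional TYPE('a)"
    and "right_comodule_algebra cm_comult cm_counit \<rho>"
  shows "\<not> right_hopf_galois \<rho>"
  using hopf_galois_imp_finite_dimensional[OF assms] connes_moscovici_infinite_dimensional by blast

end
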